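(* Let $I\subseteq\mathbb R$ be an open interval, $n\ge1$, and let $f:I\times\mathbb R^n\to\mathbb R^n$ be a continuous function which is $C^3$ in $x$. For $(\tau,\xi)\in I\times\mathbb R^n$ let $\varphi(t,\tau,\xi)$, $t\in I(\tau,\xi)$, be the maximal solution of $\frac{dx}{dt}=f(t,x)$ with $\varphi(\tau,\tau,\xi)=\xi$. Then the system $\frac{dx}{dt}=f(t,x)$ is a vector Riccati equation if and only if $$d^3\varphi\otimes d\varphi+d\varphi\otimes d^3\varphi-3\,(d^2\varphi)^2=0$$ for all $(\tau,\xi)\in I\times\mathbb R^n$, all $t\in I(\tau,\xi)$ and all $h\in\mathbb R^n$, where $d^k\varphi=D^k\varphi(t,\tau,\xi)\,h^k$ is the $k$-th differential of $\varphi$ with respect to $\xi$.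
   Context: The system is called a vector Riccati equation if there are continuous vector functions $a,c:I\to\mathbb R^n$ and a continuous $n\times n$ matrix function $B$ on $I$ such that $f(t,x)=a(t)+B(t)x+(c(t)^Tx)\,x$ for all $(t,x)\in I\times\mathbb R^n$. Vectors are columns; $\otimes$ is the Kronecker product $A\otimes B=[a_{rs}B]$; for a column $v$, $v^k$ is the Kronecker product of $v$ with itself $k$ times. For a $C^1$ matrix function $M$ of a variable in $\mathbb R^n$, $DM=[\frac{\partial}{\partial x_1}M\ \cdots\ \frac{\partial}{\partial x_n}M]$ (block matrix); for a vector function $g$, $Dg$ is the Jacobi matrix and $D^mg=D(D^{m-1}g)$, so that $D^mg(x)h^m$ is the $m$-th differential of $g$ at $x$ in direction $h$. $D$ applied to $\varphi$ is with respect to $\xi$. "$C^3$ in $x$" means that the partial derivatives with respect to $x$ up to order $3$ exist and are continuous on $I\times\mathbb R^n$. $I(\tau,\xi)\subseteq I$ is the maximal interval of existence. *)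

theory Defs
  imports "HOL-Analysis.Analysis"
begin

definition partial_deriv :: "'n::finite \<Rightarrow> (real ^ 'n \<Rightarrow> 'b::real_normed_vector) \<Rightarrow> real ^ 'n \<Rightarrow> 'b" where
  "partial_deriv i g x = vector_derivative (\<lambda>s. g (x + s *\<^sub>R axis i 1)) (at 0)"

text \<open>All iterated partial derivatives with respect to \<open>x\<close> of order at most \<open>k\<close>, mixed ones in
  every order of differentiation, exist and are jointly continuous in \<open>(t, x)\<close>.\<close>

primrec C_in_x :: "nat \<Rightarrow> real set \<Rightarrow> (real \<Rightarrow> real ^ 'n \<Rightarrow> 'b::real_normed_vector) \<Rightarrow> bool" where
  "C_in_x 0 I f \<longleftrightarrow> continuous_on (I \<times> UNIV) (\<lambda>(t, x). f t x)"
| "C_in_x (Suc k) I f \<longleftrightarrow>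
     continuous_on (I \<times> UNIV) (\<lambda>(t, x). f t x) \<and>
     (\<forall>i. (\<forall>t\<in>I. \<forall>x. (\<lambda>s. f t (x + s *\<^sub>R axis i 1)) differentiable (at 0)) \<and>
          C_in_x k I (\<lambda>t. partial_deriv i (f t)))"

definition vector_riccati :: "real set \<Rightarrow> (real \<Rightarrow> real ^ 'n \<Rightarrow> real ^ 'n::finite) \<Rightarrow> bool" where
  "vector_riccati I f \<longleftrightarrow>
     (\<exists>(a :: real \<Rightarrow> real ^ 'n) (B :: real \<Rightarrow> real ^ 'n ^ 'n) (c :: real \<Rightarrow> real ^ 'n).
        continuous_on I a \<and> continuous_on I B \<and> continuous_on I c \<and>
        (\<forall>t\<in>I. \<forall>x. f t x = a t + B t *v x + (c t \<bullet> x) *\<^sub>R x))"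

definition ivp_solution ::
  "real set \<Rightarrow> (real \<Rightarrow> real ^ 'n \<Rightarrow> real ^ 'n) \<Rightarrow> real \<Rightarrow> real ^ 'n::finite \<Rightarrow>
     real set \<Rightarrow> (real \<Rightarrow> real ^ 'n) \<Rightarrow> bool" where
  "ivp_solution I f \<tau> \<xi> J x \<longleftrightarrow>
     open J \<and> is_interval J \<and> J \<subseteq> I \<and> \<tau> \<in> J \<and> x \<tau> = \<xi> \<and>
     (\<forall>t\<in>J. (x has_vector_derivative f t (x t)) (at t))"

text \<open>Only the values of \<open>x\<close> on \<open>J\<close> are constrained. Maximality means that the solution has no
  extension to a strictly larger interval.\<close>

definition maximal_ivp_solution ::
  "real set \<Rightarrow> (real \<Rightarrow> real ^ 'n \<Rightarrow> real ^ 'n) \<Rightarrow> real \<Rightarrow> real ^ 'n::finite \<Rightarrow>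
     real set \<Rightarrow> (real \<Rightarrow> real ^ 'n) \<Rightarrow> bool" where
  "maximal_ivp_solution I f \<tau> \<xi> J x \<longleftrightarrow>
     ivp_solution I f \<tau> \<xi> J x \<and>
     (\<forall>J' x'. ivp_solution I f \<tau> \<xi> J' x' \<and> J \<subseteq> J' \<and> (\<forall>t\<in>J. x' t = x t) \<longrightarrow> J' = J)"

text \<open>The Kronecker product \<open>[v\<^sub>r w]\<close> of two columns: the pair \<open>(r, s)\<close> stands for entry \<open>s\<close> of
  block \<open>r\<close>. Powers are bracketed to the right.\<close>

definition kronecker :: "real ^ 'a::finite \<Rightarrow> real ^ 'b::finite \<Rightarrow> real ^ ('a \<times> 'b)" (infixr "\<otimes>" 70) where
  "v \<otimes> w = (\<chi> p. v $ fst p * w $ snd p)"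

text \<open>The block matrix of the partial derivatives of \<open>M\<close>: the column index \<open>(i, j)\<close> stands for
  column \<open>j\<close> of the \<open>i\<close>-th block.\<close>

definition block_D :: "(real ^ 'n::finite \<Rightarrow> real ^ 'c::finite ^ 'r::finite) \<Rightarrow> real ^ 'n \<Rightarrow> real ^ ('n \<times> 'c) ^ 'r" where
  "block_D M x = (\<chi> r p. partial_deriv (fst p) M x $ r $ snd p)"

definition D1 :: "(real ^ 'n::finite \<Rightarrow> real ^ 'm::finite) \<Rightarrow> real ^ 'n \<Rightarrow> real ^ 'n ^ 'm" where
  "D1 g x = jacobian g (at x)"

definition D2 :: "(real ^ 'n::finite \<Rightarrow> real ^ 'm::finite) \<Rightarrow> real ^ 'n \<Rightarrow> real ^ ('n \<times> 'n) ^ 'm" where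
  "D2 g = block_D (D1 g)"

definition D3 :: "(real ^ 'n::finite \<Rightarrow> real ^ 'm::finite) \<Rightarrow> real ^ 'n \<Rightarrow> real ^ ('n \<times> 'n \<times> 'n) ^ 'm" where
  "D3 g = block_D (D2 g)"

end

theory Submission
  imports Defs
begin

text \<open>
Write \<open>d\<^sub>k\<close> for the \<open>k\<close>-th differential of the flow in a fixed direction \<open>h\<close>. Differentiating the
equation in \<open>\<xi>\<close> shows that \<open>\<partial>d\<^sub>k/\<partial>t\<close> is the \<open>k\<close>-th differential of \<open>\<xi> \<mapsto> f(t, \<phi>(t, \<tau>, \<xi>))\<close>, with
initial values \<open>h, 0, 0\<close> at \<open>t = \<tau>\<close>. If \<open>f\<close> is a vector Riccati function, uniqueness for these linear
equations gives \<open>d\<^sub>2 = k d\<^sub>1\<close> and \<open>d\<^sub>3 = (3/2) k\<^sup>2 d\<^sub>1\<close>, where \<open>k' = 2 c\<^sup>T d\<^sub>1\<close> and \<open>k(\<tau>) = 0\<close>, and the identity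
follows.

Conversely, the identity forces \<open>d\<^sub>2\<close> to be parallel to \<open>d\<^sub>1\<close>. Differentiating the identity and
this parallelism at \<open>t = \<tau>\<close> yields \<open>D\<^sup>3f h\<^sup>3 = 0\<close> and \<open>D\<^sup>2f h\<^sup>2\<close> parallel to \<open>h\<close> for all \<open>h\<close>. So \<open>f\<close> is
quadratic in \<open>x\<close>, and a quadratic map whose values are parallel to their arguments is
\<open>x \<mapsto> (c\<^sup>Tx) x\<close>.
\<close>

text \<open>Since \<open>f\<close> is merely continuous in \<open>t\<close>, the identity can in
  general be differentiated in \<open>t\<close> only once. At \<open>t = \<tau>\<close> the second
  and third differentials vanish, so the term quadratic in the second differential contributes
  nothing to that derivative, and the identity alone yields only the condition on the third
  differential of \<open>f\<close>. The condition on the second one has to come from the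
  parallelism, which is bilinear and keeps a first-order term. The parallelism is algebra at a fixed
  time: three entries of the identity force the square of each 2x2 minor to vanish. The analytic
  obstacle is that the hypotheses give, for each initial value, just a solution without proper
  extension. That the domain of the flow is open and that the flow is three times differentiable in
  \<xi> must be proved. Time is rescaled to run from 0 to 1, so that compactness gives uniform
  constants and derivatives at \<tau> become right derivatives at 0. Differentiability is proved
  once, to first order; higher orders come from enlarging the system by its own variations.\<close>

section \<open>Differential equations on a compact time interval\<close>

text \<open>Continuity of \<open>F'\<close> is required for each direction separately; in finite dimension this is
  continuity in the operator norm.\<close>

definition C1x :: "real set \<Rightarrow> (real \<Rightarrow> 'a::real_normed_vector \<Rightarrow> 'b::real_normed_vector) \<Rightarrow>
    (real \<Rightarrow> 'a \<Rightarrow> 'a \<Rightarrow> 'b) \<Rightarrow> bool" where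
  "C1x S F F' \<longleftrightarrow> continuous_on (S \<times> UNIV) (\<lambda>(t, x). F t x) \<and>
     (\<forall>t\<in>S. \<forall>x. (F t has_derivative F' t x) (at x)) \<and>
     (\<forall>v. continuous_on (S \<times> UNIV) (\<lambda>(t, x). F' t x v))"

definition solves :: "real \<Rightarrow> (real \<Rightarrow> 'a::real_normed_vector \<Rightarrow> 'a) \<Rightarrow> (real \<Rightarrow> 'a) \<Rightarrow> bool" where
  "solves b F x \<longleftrightarrow> (\<forall>t\<in>{0..b}. (x has_vector_derivative F t (x t)) (at t within {0..b}))"

lemma solvesD: "solves b F x \<Longrightarrow> t \<in> {0..b} \<Longrightarrow> (x has_vector_derivative F t (x t)) (at t within {0..b})"
  by (simp add: solves_def)

lemma solves_continuous: "solves b F x \<Longrightarrow> continuous_on {0..b} x"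
  unfolding solves_def continuous_on_eq_continuous_within
  by (blast intro: has_vector_derivative_continuous)

lemma continuous_on_compose_Pair:
  assumes "continuous_on (S \<times> UNIV) (\<lambda>(t, x). F t x)" "continuous_on T g" "continuous_on T u" "g ` T \<subseteq> S"
  shows "continuous_on T (\<lambda>s. F (g s) (u s))"
proof -
  have "continuous_on T (\<lambda>s. (\<lambda>(t, x). F t x) (g s, u s))"
    by (rule continuous_on_compose2[OF assms(1)]) (use assms in \<open>auto intro!: continuous_intros\<close>)
  then show ?thesis by simp
qed

text \<open>The estimate comes from the monotonicity of \<open>(\<bar>r\<bar>\<^sup>2 + e\<^sup>2) exp(-(2K+1)t)\<close>.\<close>

lemma gronwall:
  fixes r :: "real \<Rightarrow> 'a::real_inner"
  assumes r: "\<And>t. t \<in> {0..b} \<Longrightarrow> (r has_vector_derivative r' t) (at t within {0..b})"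
    and bd: "\<And>t. t \<in> {0..b} \<Longrightarrow> norm (r' t) \<le> K * norm (r t) + e"
    and "0 \<le> K" "0 \<le> e" and t: "t \<in> {0..b}"
  shows "norm (r t) \<le> (norm (r 0) + e) * exp ((2 * K + 1) * b)"
proof -
  define M where "M = 2 * K + 1"
  define G where "G s = ((norm (r s))\<^sup>2 + e\<^sup>2) * exp (- M * s)" for s
  have G': "(G has_derivative (\<lambda>h. h * ((2 * (r s \<bullet> r' s) - M * ((norm (r s))\<^sup>2 + e\<^sup>2)) * exp (- M * s))))
      (at s within {0..t})" if s: "s \<in> {0..t}" for s
  proof -
    have "(r has_derivative (\<lambda>h. h *\<^sub>R r' s)) (at s within {0..t})"
      using r[of s] s t has_vector_derivative_within_subset[of r "r' s" s "{0..b}" "{0..t}"]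
      by (auto simp: has_vector_derivative_def)
    then show ?thesis
      unfolding G_def power2_norm_eq_inner
      by (auto intro!: derivative_eq_intros simp: algebra_simps inner_commute)
  qed
  have "0 \<le> t" using t by simp
  from mvt_very_simple[OF this G'] obtain s where s: "s \<in> {0..t}"
    and Geq: "G t - G 0 = (t - 0) * ((2 * (r s \<bullet> r' s) - M * ((norm (r s))\<^sup>2 + e\<^sup>2)) * exp (- M * s))"
    by auto
  have "r s \<bullet> r' s \<le> norm (r s) * (K * norm (r s) + e)"
    using s t by (intro order_trans[OF norm_cauchy_schwarz] mult_left_mono bd) auto
  also have "2 * (norm (r s) * (K * norm (r s) + e)) \<le> M * ((norm (r s))\<^sup>2 + e\<^sup>2)"
  proof -
    have "0 \<le> (norm (r s) - e)\<^sup>2 + 2 * K * e\<^sup>2" using \<open>0 \<le> K\<close> by simp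
    then show ?thesis unfolding M_def by (simp add: power2_eq_square algebra_simps)
  qed
  finally have "(t - 0) * ((2 * (r s \<bullet> r' s) - M * ((norm (r s))\<^sup>2 + e\<^sup>2)) * exp (- M * s)) \<le> 0"
    using t by (intro mult_nonneg_nonpos mult_nonpos_nonneg) auto
  then have "G t \<le> G 0" using Geq by simp
  then have "((norm (r t))\<^sup>2 + e\<^sup>2) * exp (- M * t) \<le> (norm (r 0))\<^sup>2 + e\<^sup>2"
    by (simp add: G_def)
  then have "(norm (r t))\<^sup>2 + e\<^sup>2 \<le> ((norm (r 0))\<^sup>2 + e\<^sup>2) * exp (M * t)"
    by (simp add: exp_minus field_simps)
  also have "\<dots> \<le> (norm (r 0) + e)\<^sup>2 * exp (M * b)"
    using \<open>0 \<le> e\<close> \<open>0 \<le> K\<close> t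
    by (intro mult_mono) (auto simp: power2_eq_square algebra_simps M_def intro!: add_mono mult_left_mono)
  \<comment> \<open>Squaring the factor \<open>exp (M * b) \<ge> 1\<close> makes the right-hand side
    a perfect square, so the root can be taken without halving the exponent.\<close>
  also have "\<dots> \<le> (norm (r 0) + e)\<^sup>2 * (exp (M * b))\<^sup>2"
    using \<open>0 \<le> K\<close> t by (intro mult_left_mono) (auto simp: power2_eq_square M_def exp_add[symmetric])
  finally have "(norm (r t))\<^sup>2 \<le> ((norm (r 0) + e) * exp (M * b))\<^sup>2"
    by (smt (verit) power_mult_distrib zero_le_power2)
  then show ?thesis
    unfolding M_def by (rule power2_le_imp_le) (use \<open>0 \<le> e\<close> in simp)
qed

text \<open>With the unknown \<open>u(t) = exp(-2Kt) x(t)\<close> the Picard operator is a contraction on the whole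
  interval.\<close>

lemma picard_global:
  fixes F :: "real \<Rightarrow> 'a::euclidean_space \<Rightarrow> 'a"
  assumes cont: "continuous_on ({0..b} \<times> UNIV) (\<lambda>(t, x). F t x)"
    and lip: "\<And>t x y. t \<in> {0..b} \<Longrightarrow> norm (F t x - F t y) \<le> K * norm (x - y)"
    and "0 < K" "0 \<le> b"
  obtains x where "solves b F x" "x 0 = \<xi>"
proof -
  define w where "w u t = exp (- 2 * K * t) *\<^sub>R (\<xi> + integral {0..t} (\<lambda>s. F s (exp (2 * K * s) *\<^sub>R u s)))"
    for u t
  \<comment> \<open>The type of bounded continuous functions lives on the whole line;
    \<open>clamp\<close> extends a function on \<open>{0..b}\<close> by its end values.\<close>
  define P where "P u = Bcontfun (\<lambda>t. w (apply_bcontfun u) (clamp 0 b t))" for u :: "real \<Rightarrow>\<^sub>C 'a"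
  have Fcont: "continuous_on {0..b} (\<lambda>s. F s (exp (2 * K * s) *\<^sub>R apply_bcontfun u s))" for u
    by (rule continuous_on_compose_Pair[OF cont]) (auto intro!: continuous_intros)
  have wcont: "continuous_on (cbox 0 b) (w (apply_bcontfun u))" for u
    unfolding w_def
    by (auto intro!: continuous_intros indefinite_integral_continuous_1 integrable_continuous_interval Fcont)
  have P: "apply_bcontfun (P u) t = w u (clamp 0 b t)" for u t
  proof -
    have "(\<lambda>t. w (apply_bcontfun u) (clamp 0 b t)) \<in> bcontfun"
      unfolding bcontfun_def
      using clamp_continuous_on[OF wcont] clamp_bounded compact_imp_bounded[OF compact_continuous_image[OF wcont compact_cbox]]
      by blast
    then show ?thesis by (simp add: P_def Bcontfun_inverse)
  qed
  have contr: "dist (P u) (P v) \<le> 1 / 2 * dist u v" for u v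
  proof (rule dist_bound)
    fix t0
    define t where "t = clamp 0 b t0"
    have t: "t \<in> {0..b}" unfolding t_def
      using clamp_in_interval[of 0 b t0] \<open>0 \<le> b\<close> by (simp add: cbox_interval)
    let ?f = "\<lambda>u s. F s (exp (2 * K * s) *\<^sub>R apply_bcontfun u s)"
    have int: "?f u integrable_on {0..t}" for u
      using t by (intro integrable_continuous_interval continuous_on_subset[OF Fcont]) auto
    \<comment> \<open>The exponent \<open>2 * K\<close> of the weight is chosen here:
      \<open>K\<close> times the integral of \<open>exp (2 * K * s)\<close> is at most
      \<open>exp (2 * K * t) / 2\<close>, which gives the contraction factor 1/2 whatever the length
      \<open>b\<close>.\<close>
    have hi: "((\<lambda>s. K * (exp (2 * K * s) * dist u v)) has_integral
        exp (2 * K * t) * dist u v / 2 - exp (2 * K * 0) * dist u v / 2) {0..t}"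
      using t \<open>0 < K\<close>
      by (intro fundamental_theorem_of_calculus)
        (auto intro!: derivative_eq_intros simp: has_real_derivative_iff_has_vector_derivative[symmetric])
    have "norm (integral {0..t} (\<lambda>s. ?f u s - ?f v s)) \<le> integral {0..t} (\<lambda>s. K * (exp (2 * K * s) * dist u v))"
    proof (rule integral_norm_bound_integral)
      fix s assume s: "s \<in> {0..t}"
      have "norm (?f u s - ?f v s) \<le> K * norm (exp (2 * K * s) *\<^sub>R apply_bcontfun u s - exp (2 * K * s) *\<^sub>R apply_bcontfun v s)"
        using s t by (intro lip) auto
      also have "\<dots> = K * (exp (2 * K * s) * dist (apply_bcontfun u s) (apply_bcontfun v s))"
        by (simp add: dist_norm scaleR_diff_right[symmetric])
      also have "\<dots> \<le> K * (exp (2 * K * s) * dist u v)"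
        using \<open>0 < K\<close> by (intro mult_left_mono dist_bounded) auto
      finally show "norm (?f u s - ?f v s) \<le> K * (exp (2 * K * s) * dist u v)" .
    qed (use hi int in \<open>auto intro!: integrable_diff\<close>)
    also have "\<dots> = exp (2 * K * t) * dist u v / 2 - dist u v / 2"
      using integral_unique[OF hi] by simp
    also have "\<dots> \<le> exp (2 * K * t) * dist u v / 2" by simp
    finally have *: "norm (integral {0..t} (?f u) - integral {0..t} (?f v)) \<le> exp (2 * K * t) * dist u v / 2"
      by (simp add: integral_diff[OF int int])
    have "dist (w u t) (w v t) = exp (- 2 * K * t) * norm (integral {0..t} (?f u) - integral {0..t} (?f v))"
      unfolding w_def dist_norm by (simp add: scaleR_diff_right[symmetric])
    also have "\<dots> \<le> exp (- 2 * K * t) * (exp (2 * K * t) * dist u v / 2)"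
      by (intro mult_left_mono *) auto
    also have "\<dots> = 1 / 2 * dist u v" by (simp add: exp_minus)
    finally show "dist (P u t0) (P v t0) \<le> 1 / 2 * dist u v" by (simp add: P t_def)
  qed
  obtain u where u: "P u = u"
    using banach_fix_type[of "1/2" P] contr by auto
  define x where "x t = \<xi> + integral {0..t} (\<lambda>s. F s (exp (2 * K * s) *\<^sub>R apply_bcontfun u s))" for t
  have x: "exp (2 * K * t) *\<^sub>R apply_bcontfun u t = x t" if "t \<in> {0..b}" for t
  proof -
    have "apply_bcontfun u t = w u t"
      using P[of u t] that by (simp add: u)
    then show ?thesis by (simp add: w_def x_def exp_minus)
  qed
  have "(x has_vector_derivative F t (x t)) (at t within {0..b})" if t: "t \<in> {0..b}" for t
  proof -
    have "((\<lambda>t. integral {0..t} (\<lambda>s. F s (exp (2 * K * s) *\<^sub>R apply_bcontfun u s))) has_vector_derivative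
        F t (exp (2 * K * t) *\<^sub>R apply_bcontfun u t)) (at t within {0..b})"
      by (rule integral_has_vector_derivative[OF Fcont t])
    then show ?thesis
      using x[OF t] unfolding x_def has_vector_derivative_def
      by (auto intro!: derivative_eq_intros)
  qed
  then have "solves b F x" by (simp add: solves_def)
  moreover have "x 0 = \<xi>" by (simp add: x_def)
  ultimately show ?thesis by (rule that)
qed


section \<open>Uniform estimates for continuously differentiable right-hand sides\<close>

lemma C1x_continuous_on: "C1x S F F' \<Longrightarrow> continuous_on (S \<times> UNIV) (\<lambda>(t, x). F t x)"
  and C1x_has_derivative: "C1x S F F' \<Longrightarrow> t \<in> S \<Longrightarrow> (F t has_derivative F' t x) (at x)"
  and C1x_continuous_on_derivative: "C1x S F F' \<Longrightarrow> continuous_on (S \<times> UNIV) (\<lambda>(t, x). F' t x v)"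
  by (auto simp: C1x_def)

text \<open>With the derivative as a point of a normed space, compactness of
  \<open>S \<times> cball 0 R\<close> yields a bound and uniform continuity for it. Checking
  continuity on the finitely many basis vectors is enough.\<close>

lemma C1x_blinfun:
  fixes F :: "real \<Rightarrow> 'a::euclidean_space \<Rightarrow> 'b::real_normed_vector"
  assumes "C1x S F F'"
  obtains A where "continuous_on (S \<times> UNIV) A" "\<And>t x. t \<in> S \<Longrightarrow> blinfun_apply (A (t, x)) = F' t x"
proof -
  define A where "A p = Blinfun (F' (fst p) (snd p))" for p
  have A: "blinfun_apply (A (t, x)) = F' t x" if "t \<in> S" for t x
    unfolding A_def
    using has_derivative_bounded_linear[OF C1x_has_derivative[OF assms that]]
    by (simp add: bounded_linear_Blinfun_apply)
  have "continuous_on (S \<times> UNIV) A"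
  proof (rule continuous_on_blinfun_componentwise)
    fix i :: 'a
    show "continuous_on (S \<times> UNIV) (\<lambda>p. blinfun_apply (A p) i)"
      using C1x_continuous_on_derivative[OF assms, of i]
      by (rule continuous_on_cong[THEN iffD1, rotated -1]) (auto simp: A)
  qed
  with A show ?thesis using that by blast
qed

text \<open>The derivative is bounded on the compact set \<open>S \<times> cball 0 R\<close>, and
  the ball is convex, so the mean value inequality turns the same bound into a Lipschitz constant.
  The constant depends on \<open>R\<close>, as the derivative may grow at infinity.\<close>

lemma C1x_lipschitz:
  fixes F :: "real \<Rightarrow> 'a::euclidean_space \<Rightarrow> 'b::real_normed_vector"
  assumes C: "C1x S F F'" and "compact S"
  obtains K where "0 < K"
    "\<And>t x v. t \<in> S \<Longrightarrow> x \<in> cball 0 R \<Longrightarrow> norm (F' t x v) \<le> K * norm v"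
    "\<And>t x y. t \<in> S \<Longrightarrow> x \<in> cball 0 R \<Longrightarrow> y \<in> cball 0 R \<Longrightarrow> norm (F t x - F t y) \<le> K * norm (x - y)"
proof -
  obtain A where A: "continuous_on (S \<times> UNIV) A" "\<And>t x. t \<in> S \<Longrightarrow> blinfun_apply (A (t, x)) = F' t x"
    using C1x_blinfun[OF C] by blast
  have "compact (A ` (S \<times> cball 0 R))"
    by (intro compact_continuous_image continuous_on_subset[OF A(1)] compact_Times) (use assms in auto)
  then obtain K where K: "0 < K" "\<And>p. p \<in> S \<times> cball 0 R \<Longrightarrow> norm (A p) \<le> K"
    using compact_imp_bounded[THEN bounded_pos[THEN iffD1]] by (metis imageI)
  have on: "onorm (F' t x) \<le> K" if "t \<in> S" "x \<in> cball 0 R" for t x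
    using K(2)[of "(t, x)"] A(2)[OF that(1), of x] that by (simp add: norm_blinfun.rep_eq)
  have "norm (F' t x v) \<le> K * norm v" if "t \<in> S" "x \<in> cball 0 R" for t x v
    using onorm[OF has_derivative_bounded_linear[OF C1x_has_derivative[OF C that(1)]], of x v] on[OF that]
    by (meson mult_right_mono norm_ge_zero order_trans)
  moreover have "norm (F t x - F t y) \<le> K * norm (x - y)"
    if "t \<in> S" "x \<in> cball 0 R" "y \<in> cball 0 R" for t x y
    by (rule differentiable_bound[of "cball 0 R" "F t" "F' t"])
      (use that on C1x_has_derivative[OF C] in \<open>auto intro: has_derivative_at_withinI\<close>)
  ultimately show ?thesis using that K(1) by blast
qed

text \<open>One \<delta> serves all times and all base points of the ball. The Gronwall argument for
  the flow follows a whole trajectory and needs this uniformity.\<close>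

lemma C1x_uniform_linearization:
  fixes F :: "real \<Rightarrow> 'a::euclidean_space \<Rightarrow> 'b::real_normed_vector"
  assumes C: "C1x S F F'" and "compact S" and "0 < \<epsilon>"
  obtains \<delta> where "0 < \<delta>"
    "\<And>t x y. t \<in> S \<Longrightarrow> x \<in> cball 0 R \<Longrightarrow> dist x y < \<delta> \<Longrightarrow>
      norm (F t y - F t x - F' t x (y - x)) \<le> \<epsilon> * norm (y - x)"
proof -
  obtain A where A: "continuous_on (S \<times> UNIV) A" "\<And>t x. t \<in> S \<Longrightarrow> blinfun_apply (A (t, x)) = F' t x"
    using C1x_blinfun[OF C] by blast
  \<comment> \<open>The radius \<open>R + 1\<close> leaves room for \<open>y\<close>, which may lie
    outside \<open>cball 0 R\<close> but, since \<delta> will be at most 1, not outside the larger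
    ball.\<close>
  have "uniformly_continuous_on (S \<times> cball 0 (R + 1)) A"
    by (intro compact_uniformly_continuous continuous_on_subset[OF A(1)] compact_Times) (use assms in auto)
  then obtain d where d: "0 < d"
    "\<And>p q. p \<in> S \<times> cball 0 (R + 1) \<Longrightarrow> q \<in> S \<times> cball 0 (R + 1) \<Longrightarrow> dist q p < d \<Longrightarrow> dist (A q) (A p) < \<epsilon>"
    unfolding uniformly_continuous_on_def using \<open>0 < \<epsilon>\<close> by metis
  define \<delta> where "\<delta> = min d 1"
  have "norm (F t y - F t x - F' t x (y - x)) \<le> \<epsilon> * norm (y - x)"
    if t: "t \<in> S" and x: "x \<in> cball 0 R" and y: "dist x y < \<delta>" for t x y
  proof -
    have on: "onorm (F' t z - F' t x) \<le> \<epsilon>" if z: "z \<in> ball x \<delta>" for z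
    proof -
      have "norm z \<le> norm x + dist x z" by (metis dist_norm norm_minus_commute norm_triangle_sub)
      then have "dist (A (t, z)) (A (t, x)) < \<epsilon>"
        using z t x by (intro d(2)) (auto simp: \<delta>_def dist_Pair_Pair dist_commute)
      moreover have "blinfun_apply (A (t, z) - A (t, x)) = F' t z - F' t x"
        using A(2)[OF t] by (auto simp: minus_blinfun.rep_eq)
      ultimately show ?thesis by (simp add: dist_norm norm_blinfun.rep_eq)
    qed
    have seg: "x + s *\<^sub>R (y - x) \<in> ball x \<delta>" if "s \<in> {0..1}" for s
    proof -
      have "dist x (x + s *\<^sub>R (y - x)) = s * dist x y" using that by (simp add: dist_norm norm_minus_commute)
      also have "\<dots> \<le> dist x y" using that by (simp add: mult_left_le_one_le)
      finally show ?thesis using y by simp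
    qed
    have "norm (F t y - F t x - F' t x (y - x)) \<le> norm (y - x) * \<epsilon>"
      by (rule differentiable_bound_linearization[where S = "ball x \<delta>"])
        (use seg on d(1) C1x_has_derivative[OF C t] in \<open>auto simp: \<delta>_def intro: has_derivative_at_withinI\<close>)
    then show ?thesis by (simp add: mult.commute)
  qed
  moreover have "0 < \<delta>" using d(1) by (simp add: \<delta>_def)
  ultimately show ?thesis using that by blast
qed

lemma solves_bounded:
  assumes "solves b F x"
  obtains R where "\<And>t. t \<in> {0..b} \<Longrightarrow> norm (x t) \<le> R"
proof -
  have "bounded (x ` {0..b})"
    by (intro compact_imp_bounded compact_continuous_image solves_continuous[OF assms] compact_Icc)
  then show ?thesis using that unfolding bounded_iff by blast
qed

text \<open>On a compact interval both solutions stay in a common ball, where \<open>F\<close> is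
  Lipschitz; \<open>gronwall\<close> with \<open>e = 0\<close> then bounds their difference by its
  initial value 0.\<close>

lemma solves_unique:
  fixes F :: "real \<Rightarrow> 'a::euclidean_space \<Rightarrow> 'a"
  assumes C: "C1x {0..b} F F'" and x: "solves b F x" and y: "solves b F y" and eq: "x 0 = y 0"
    and t: "t \<in> {0..b}"
  shows "x t = y t"
proof -
  obtain R1 R2 where R1: "\<And>t. t \<in> {0..b} \<Longrightarrow> norm (x t) \<le> R1" and R2: "\<And>t. t \<in> {0..b} \<Longrightarrow> norm (y t) \<le> R2"
    using solves_bounded[OF x] solves_bounded[OF y] by metis
  obtain K where K: "0 < K"
    "\<And>t u v. t \<in> {0..b} \<Longrightarrow> u \<in> cball 0 (max R1 R2) \<Longrightarrow> v \<in> cball 0 (max R1 R2) \<Longrightarrow> norm (F t u - F t v) \<le> K * norm (u - v)"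
    using C1x_lipschitz[OF C compact_Icc, of "max R1 R2"] by metis
  have "norm (x t - y t) \<le> (norm (x 0 - y 0) + 0) * exp ((2 * K + 1) * b)"
  proof (rule gronwall[where r' = "\<lambda>t. F t (x t) - F t (y t)", OF _ _ _ _ t])
    fix t assume "t \<in> {0..b}"
    then show "norm (F t (x t) - F t (y t)) \<le> K * norm (x t - y t) + 0"
      using R1[of t] R2[of t] K(2)[of t "x t" "y t"] by (auto simp: le_max_iff_disj)
  qed (use K(1) in \<open>auto intro!: derivative_intros solvesD[OF x] solvesD[OF y]\<close>)
  then show ?thesis by (simp add: eq)
qed

text \<open>Retracting \<open>x - x0(t)\<close> to the unit ball makes \<open>F\<close> globally Lipschitz; by Gronwall, solutions of the
  modified equation that start close to \<open>x0\<close> never notice the modification.\<close>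

lemma solution_tube:
  fixes F :: "real \<Rightarrow> 'a::euclidean_space \<Rightarrow> 'a"
  assumes C: "C1x {0..b} F F'" and x0: "solves b F x0" and "0 \<le> b"
  obtains \<delta> M where "0 < \<delta>" "0 \<le> M"
    "\<And>\<xi>. dist \<xi> (x0 0) < \<delta> \<Longrightarrow>
      \<exists>x. solves b F x \<and> x 0 = \<xi> \<and> (\<forall>t\<in>{0..b}. norm (x t - x0 t) \<le> M * norm (\<xi> - x0 0))"
proof -
  define c :: "'a \<Rightarrow> 'a" where "c = closest_point (cball 0 1)"
  have c_lip: "norm (c u - c v) \<le> norm (u - v)" for u v
    using closest_point_lipschitz[of "cball 0 1" u v] by (simp add: c_def dist_norm)
  have c_mem: "norm (c u) \<le> 1" for u
    using closest_point_in_set[of "cball 0 1" u] by (simp add: c_def)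
  have c_id: "c u = u" if "norm u \<le> 1" for u
    using that by (simp add: c_def closest_point_self)
  have c_cont: "continuous_on UNIV c"
    unfolding c_def by (rule continuous_on_closest_point) auto
  obtain R where R: "\<And>t. t \<in> {0..b} \<Longrightarrow> norm (x0 t) \<le> R" using solves_bounded[OF x0] by metis
  obtain K where K: "0 < K"
    "\<And>t u v. t \<in> {0..b} \<Longrightarrow> u \<in> cball 0 (R + 1) \<Longrightarrow> v \<in> cball 0 (R + 1) \<Longrightarrow> norm (F t u - F t v) \<le> K * norm (u - v)"
    using C1x_lipschitz[OF C compact_Icc, of "R + 1"] by metis
  define G where "G t x = F t (x0 t + c (x - x0 t))" for t x
  have G_lip: "norm (G t x - G t y) \<le> K * norm (x - y)" if t: "t \<in> {0..b}" for t x y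
  proof -
    have "x0 t + c u \<in> cball 0 (R + 1)" for u
      using norm_triangle_ineq[of "x0 t" "c u"] R[OF t] c_mem[of u] by simp
    then have "norm (G t x - G t y) \<le> K * norm (c (x - x0 t) - c (y - x0 t))"
      unfolding G_def using K(2)[OF t, of "x0 t + c (x - x0 t)" "x0 t + c (y - x0 t)"] by simp
    also have "\<dots> \<le> K * norm (x - y)"
      using K(1) c_lip[of "x - x0 t" "y - x0 t"] by (intro mult_left_mono) auto
    finally show ?thesis .
  qed
  have "continuous_on ({0..b} \<times> UNIV) (\<lambda>p. F (fst p) (x0 (fst p) + c (snd p - x0 (fst p))))"
    by (rule continuous_on_compose_Pair[OF C1x_continuous_on[OF C]])
      (auto intro!: continuous_intros continuous_on_compose2[OF solves_continuous[OF x0]]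
        continuous_on_compose2[OF c_cont])
  then have G_cont: "continuous_on ({0..b} \<times> UNIV) (\<lambda>(t, x). G t x)"
    by (simp add: G_def case_prod_beta)
  define M where "M = exp ((2 * K + 1) * b)"
  have "M > 0" by (simp add: M_def)
  \<comment> \<open>As \<open>c 0 = 0\<close>, the function \<open>x0\<close> solves the modified
    equation too, and Gronwall bounds the distance from \<open>x0\<close> by
    \<open>M * norm (\<xi> - x0 0)\<close>. Starting within \<open>1 / M\<close> keeps this distance
    below 1, where \<open>c\<close> is the identity.\<close>
  have "\<exists>x. solves b F x \<and> x 0 = \<xi> \<and> (\<forall>t\<in>{0..b}. norm (x t - x0 t) \<le> M * norm (\<xi> - x0 0))"
    if \<xi>: "dist \<xi> (x0 0) < 1 / M" for \<xi>
  proof -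
    obtain x where x: "solves b G x" "x 0 = \<xi>"
      using picard_global[OF G_cont G_lip \<open>0 < K\<close> \<open>0 \<le> b\<close>] by blast
    have est: "norm (x t - x0 t) \<le> M * norm (\<xi> - x0 0)" if t: "t \<in> {0..b}" for t
    proof -
      have "norm (x t - x0 t) \<le> (norm (x 0 - x0 0) + 0) * exp ((2 * K + 1) * b)"
      proof (rule gronwall[where r' = "\<lambda>t. G t (x t) - F t (x0 t)", OF _ _ _ _ t])
        fix t assume "t \<in> {0..b}"
        then show "norm (G t (x t) - F t (x0 t)) \<le> K * norm (x t - x0 t) + 0"
          using G_lip[of t "x t" "x0 t"] by (simp add: G_def c_id)
      qed (use K(1) in \<open>auto intro!: derivative_intros solvesD[OF x(1)] solvesD[OF x0]\<close>)
      then show ?thesis by (simp add: x(2) M_def mult.commute)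
    qed
    have "G t (x t) = F t (x t)" if "t \<in> {0..b}" for t
    proof -
      have "norm (x t - x0 t) \<le> 1"
        using est[OF that] \<xi> \<open>M > 0\<close> by (simp add: dist_norm field_simps)
      then show ?thesis by (simp add: G_def c_id)
    qed
    then have "solves b F x" using x(1) by (simp add: solves_def)
    with x(2) est show ?thesis by blast
  qed
  with \<open>M > 0\<close> show ?thesis using that[of "1 / M" M] by auto
qed

section \<open>First-order differentiability of the flow\<close>

text \<open>The variational equation is linear in the unknown, hence globally Lipschitz, and
  \<open>picard_global\<close> solves it on all of \<open>{0..b}\<close>. Dependence on the initial
  vector is linear because sums and multiples of solutions are solutions and an initial value
  determines its solution.\<close>

lemma variational_solution:
  fixes F :: "real \<Rightarrow> 'a::euclidean_space \<Rightarrow> 'a"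
  assumes C: "C1x {0..b} F F'" and x: "continuous_on {0..b} x" and "0 \<le> b"
  obtains Y where "\<And>t. t \<in> {0..b} \<Longrightarrow> bounded_linear (Y t)" "\<And>v. Y 0 v = v"
    "\<And>v. solves b (\<lambda>t. F' t (x t)) (\<lambda>t. Y t v)"
proof -
  define L where "L t = F' t (x t)" for t
  obtain A where A: "continuous_on ({0..b} \<times> UNIV) A" "\<And>t x. t \<in> {0..b} \<Longrightarrow> blinfun_apply (A (t, x)) = F' t x"
    using C1x_blinfun[OF C] by blast
  have L_lin: "bounded_linear (L t)" if "t \<in> {0..b}" for t
    unfolding L_def using has_derivative_bounded_linear[OF C1x_has_derivative[OF C that]] .
  have Ax: "continuous_on ({0..b} \<times> UNIV) (\<lambda>p. A (fst p, x (fst p)))"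
    by (rule continuous_on_compose2[OF A(1)])
      (auto intro!: continuous_intros continuous_on_compose2[OF x])
  \<comment> \<open>Continuity of \<open>A\<close> in the operator norm gives continuity jointly in
    time and the vector to which the derivative is applied.\<close>
  have "continuous_on ({0..b} \<times> UNIV) (\<lambda>p. blinfun_apply (A (fst p, x (fst p))) (snd p))"
    using Ax by (intro continuous_intros)
  then have L_cont: "continuous_on ({0..b} \<times> UNIV) (\<lambda>(t, y). L t y)"
    by (rule continuous_on_cong[THEN iffD1, rotated -1]) (auto simp: A L_def)
  have "bounded (x ` {0..b})" by (intro compact_imp_bounded compact_continuous_image x compact_Icc)
  then obtain R where R: "\<And>t. t \<in> {0..b} \<Longrightarrow> norm (x t) \<le> R" unfolding bounded_iff by blast
  obtain K where K: "0 < K" "\<And>t u v. t \<in> {0..b} \<Longrightarrow> u \<in> cball 0 R \<Longrightarrow> norm (F' t u v) \<le> K * norm v"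
    using C1x_lipschitz[OF C compact_Icc, of R] by metis
  have L_bd: "norm (L t v) \<le> K * norm v" if "t \<in> {0..b}" for t v
    using K(2)[OF that, of "x t"] R[OF that] by (simp add: L_def)
  have "norm (L t u - L t v) \<le> K * norm (u - v)" if "t \<in> {0..b}" for t u v
    using L_bd[OF that, of "u - v"] bounded_linear.linear[OF L_lin[OF that]] by (simp add: linear_diff)
  then have "\<exists>y. solves b L y \<and> y 0 = v" for v
    using picard_global[OF L_cont _ K(1) \<open>0 \<le> b\<close>, of v] by metis
  then obtain y where y: "\<And>v. solves b L (y v)" "\<And>v. y v 0 = v" by metis
  have L_unique: "r t = 0" if r: "solves b L r" "r 0 = 0" and t: "t \<in> {0..b}" for r t
    using gronwall[where r = r and r' = "\<lambda>t. L t (r t)" and e = 0, OF solvesD[OF r(1)] _ _ _ t, of K] L_bd K(1) r(2)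
    by auto
  have lin: "linear (\<lambda>v. y v t)" if t: "t \<in> {0..b}" for t
  proof (rule linearI)
    fix u v :: 'a
    have "solves b L (\<lambda>t. y (u + v) t - y u t - y v t)"
      unfolding solves_def
    proof
      fix t assume t: "t \<in> {0..b}"
      have "L t (y (u + v) t - y u t - y v t) = L t (y (u + v) t) - L t (y u t) - L t (y v t)"
        using bounded_linear.linear[OF L_lin[OF t]] by (simp add: linear_diff)
      then show "((\<lambda>t. y (u + v) t - y u t - y v t) has_vector_derivative L t (y (u + v) t - y u t - y v t))
          (at t within {0..b})"
        by (auto intro!: derivative_intros solvesD[OF y(1) t])
    qed
    from L_unique[OF this _ t] show "y (u + v) t = y u t + y v t" by (simp add: y(2) diff_diff_eq)
  next
    fix c :: real and u :: 'a
    have "solves b L (\<lambda>t. y (c *\<^sub>R u) t - c *\<^sub>R y u t)"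
      unfolding solves_def
    proof
      fix t assume t: "t \<in> {0..b}"
      have "L t (y (c *\<^sub>R u) t - c *\<^sub>R y u t) = L t (y (c *\<^sub>R u) t) - c *\<^sub>R L t (y u t)"
        using bounded_linear.linear[OF L_lin[OF t]] by (simp add: linear_diff linear_scale)
      then show "((\<lambda>t. y (c *\<^sub>R u) t - c *\<^sub>R y u t) has_vector_derivative L t (y (c *\<^sub>R u) t - c *\<^sub>R y u t))
          (at t within {0..b})"
        by (auto intro!: derivative_eq_intros has_vector_derivative_diff solvesD[OF y(1) t] bounded_linear.has_vector_derivative[OF bounded_linear_scaleR_right])
    qed
    from L_unique[OF this _ t] show "y (c *\<^sub>R u) t = c *\<^sub>R y u t" by (simp add: y(2))
  qed
  show ?thesis
    by (rule that[of "\<lambda>t v. y v t"])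
      (use lin y in \<open>auto simp: linear_conv_bounded_linear L_def[abs_def]\<close>)
qed

text \<open>The remainder \<open>X \<eta> t - X \<xi> t - Y t (\<eta> - \<xi>)\<close> starts at 0
  and satisfies the variational equation up to the linearization error of \<open>F\<close> along the
  trajectory. That error is a small multiple of \<open>norm (\<eta> - \<xi>)\<close>, and Gronwall
  passes this on to the remainder.\<close>

theorem flow_differentiable:
  fixes F :: "real \<Rightarrow> 'a::euclidean_space \<Rightarrow> 'a"
  assumes C: "C1x {0..b} F F'" and "0 \<le> b" and "open U"
    and X: "\<And>\<xi>. \<xi> \<in> U \<Longrightarrow> solves b F (X \<xi>)" "\<And>\<xi>. \<xi> \<in> U \<Longrightarrow> X \<xi> 0 = \<xi>"
  obtains Y where
    "\<And>\<xi> t. \<xi> \<in> U \<Longrightarrow> t \<in> {0..b} \<Longrightarrow> ((\<lambda>\<eta>. X \<eta> t) has_derivative Y \<xi> t) (at \<xi>)"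
    "\<And>\<xi> v. \<xi> \<in> U \<Longrightarrow> solves b (\<lambda>t. F' t (X \<xi> t)) (\<lambda>t. Y \<xi> t v)"
    "\<And>\<xi> v. \<xi> \<in> U \<Longrightarrow> Y \<xi> 0 v = v"
proof -
  have "\<exists>Y. (\<forall>t\<in>{0..b}. ((\<lambda>\<eta>. X \<eta> t) has_derivative Y t) (at \<xi>)) \<and>
      (\<forall>v. solves b (\<lambda>t. F' t (X \<xi> t)) (\<lambda>t. Y t v)) \<and> (\<forall>v. Y 0 v = v)" if \<xi>: "\<xi> \<in> U" for \<xi>
  proof -
    note sol = X(1)[OF \<xi>]
    obtain Y where Y: "\<And>t. t \<in> {0..b} \<Longrightarrow> bounded_linear (Y t)" "\<And>v. Y 0 v = v"
      "\<And>v. solves b (\<lambda>t. F' t (X \<xi> t)) (\<lambda>t. Y t v)"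
      using variational_solution[OF C solves_continuous[OF sol] \<open>0 \<le> b\<close>] by blast
    obtain \<delta> M where tube: "0 < \<delta>" "0 \<le> M" "\<And>\<eta>. dist \<eta> \<xi> < \<delta> \<Longrightarrow>
        \<exists>x. solves b F x \<and> x 0 = \<eta> \<and> (\<forall>t\<in>{0..b}. norm (x t - X \<xi> t) \<le> M * norm (\<eta> - \<xi>))"
      using solution_tube[OF C sol \<open>0 \<le> b\<close>] X(2)[OF \<xi>] by metis
    obtain \<delta>' where \<delta>': "0 < \<delta>'" "ball \<xi> \<delta>' \<subseteq> U"
      using \<open>open U\<close> \<xi> open_contains_ball by blast
    \<comment> \<open>By uniqueness \<open>X \<eta>\<close> is the solution supplied by the tube, so
      the flow is Lipschitz at \<xi> in the initial value, uniformly in time.\<close>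
    have close: "norm (X \<eta> t - X \<xi> t) \<le> M * norm (\<eta> - \<xi>)"
      if \<eta>: "dist \<eta> \<xi> < min \<delta> \<delta>'" and t: "t \<in> {0..b}" for \<eta> t
    proof -
      have "\<eta> \<in> U" using \<eta> \<delta>'(2) by (auto simp: dist_commute)
      obtain x where x: "solves b F x" "x 0 = \<eta>" "\<And>t. t \<in> {0..b} \<Longrightarrow> norm (x t - X \<xi> t) \<le> M * norm (\<eta> - \<xi>)"
        using tube(3)[of \<eta>] \<eta> by auto
      have "x t = X \<eta> t"
        using solves_unique[OF C x(1) X(1)[OF \<open>\<eta> \<in> U\<close>] _ t] by (simp add: x(2) X(2)[OF \<open>\<eta> \<in> U\<close>])
      then show ?thesis using x(3)[OF t] by simp
    qed
    obtain R where R: "\<And>t. t \<in> {0..b} \<Longrightarrow> norm (X \<xi> t) \<le> R" using solves_bounded[OF sol] by metis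
    obtain K where K: "0 < K" "\<And>t u v. t \<in> {0..b} \<Longrightarrow> u \<in> cball 0 R \<Longrightarrow> norm (F' t u v) \<le> K * norm v"
      using C1x_lipschitz[OF C compact_Icc, of R] by metis
    define E where "E = exp ((2 * K + 1) * b)"
    have "((\<lambda>\<eta>. X \<eta> t) has_derivative Y t) (at \<xi>)" if t: "t \<in> {0..b}" for t
      unfolding has_derivative_at_alt
    proof (intro conjI allI impI Y(1) t)
      fix \<epsilon> :: real assume "0 < \<epsilon>"
      \<comment> \<open>\<open>E\<close> is the Gronwall factor and \<open>M\<close> the Lipschitz
        constant of the flow. The denominator uses \<open>M + 1\<close> because \<open>M\<close> may
        be 0.\<close>
      define \<epsilon>' where "\<epsilon>' = \<epsilon> / ((M + 1) * E)"
      have "0 < \<epsilon>'" using \<open>0 < \<epsilon>\<close> \<open>0 \<le> M\<close> by (simp add: \<epsilon>'_def E_def)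
      then obtain d where d: "0 < d" "\<And>t x y. t \<in> {0..b} \<Longrightarrow> x \<in> cball 0 R \<Longrightarrow> dist x y < d \<Longrightarrow>
          norm (F t y - F t x - F' t x (y - x)) \<le> \<epsilon>' * norm (y - x)"
        using C1x_uniform_linearization[OF C compact_Icc] by metis
      define d' where "d' = min (min \<delta> \<delta>') (d / (M + 1))"
      have "norm (X \<eta> t - X \<xi> t - Y t (\<eta> - \<xi>)) \<le> \<epsilon> * norm (\<eta> - \<xi>)" if \<eta>: "norm (\<eta> - \<xi>) < d'" for \<eta>
      proof -
        have \<eta>': "dist \<eta> \<xi> < min \<delta> \<delta>'" using \<eta> by (simp add: d'_def dist_norm)
        then have "\<eta> \<in> U" using \<delta>'(2) by (auto simp: dist_commute)
        have small: "M * norm (\<eta> - \<xi>) < d"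
        proof -
          have "norm (\<eta> - \<xi>) * (M + 1) < d"
            using \<eta> \<open>0 \<le> M\<close> by (simp add: d'_def pos_less_divide_eq)
          then show ?thesis by (simp add: algebra_simps) (smt (verit) norm_ge_zero)
        qed
        have "norm (X \<eta> t - X \<xi> t - Y t (\<eta> - \<xi>))
            \<le> (norm (X \<eta> 0 - X \<xi> 0 - Y 0 (\<eta> - \<xi>)) + \<epsilon>' * (M * norm (\<eta> - \<xi>))) * exp ((2 * K + 1) * b)"
        proof (rule gronwall[where r' = "\<lambda>t. F t (X \<eta> t) - F t (X \<xi> t) - F' t (X \<xi> t) (Y t (\<eta> - \<xi>))", OF _ _ _ _ t])
          fix t assume t: "t \<in> {0..b}"
          let ?x = "X \<xi> t" and ?y = "X \<eta> t" and ?z = "Y t (\<eta> - \<xi>)"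
          show "((\<lambda>t. X \<eta> t - X \<xi> t - Y t (\<eta> - \<xi>)) has_vector_derivative
              F t ?y - F t ?x - F' t ?x ?z) (at t within {0..b})"
            by (intro derivative_intros solvesD[OF X(1)[OF \<open>\<eta> \<in> U\<close>] t] solvesD[OF sol t] solvesD[OF Y(3) t])
          have lin: "linear (F' t ?x)"
            using has_derivative_bounded_linear[OF C1x_has_derivative[OF C t]] bounded_linear.linear by blast
          have "norm (F t ?y - F t ?x - F' t ?x (?y - ?x)) \<le> \<epsilon>' * norm (?y - ?x)"
            using close[OF \<eta>' t] small R[OF t] by (intro d(2)[OF t]) (auto simp: dist_norm norm_minus_commute)
          also have "\<dots> \<le> \<epsilon>' * (M * norm (\<eta> - \<xi>))"
            using close[OF \<eta>' t] \<open>0 < \<epsilon>'\<close> by (intro mult_left_mono) auto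
          finally have 1: "norm (F t ?y - F t ?x - F' t ?x (?y - ?x)) \<le> \<epsilon>' * (M * norm (\<eta> - \<xi>))" .
          have 2: "norm (F' t ?x (?y - ?x - ?z)) \<le> K * norm (?y - ?x - ?z)"
            using K(2)[OF t, of ?x] R[OF t] by simp
          \<comment> \<open>The first summand is the linearization error, the second is the linear
            part acting on the remainder; they become \<open>e\<close> and the \<open>K\<close> term
            of \<open>gronwall\<close>.\<close>
          have "F t ?y - F t ?x - F' t ?x ?z
              = (F t ?y - F t ?x - F' t ?x (?y - ?x)) + F' t ?x (?y - ?x - ?z)"
            by (simp add: linear_diff[OF lin])
          then show "norm (F t ?y - F t ?x - F' t ?x ?z) \<le> K * norm (?y - ?x - ?z) + \<epsilon>' * (M * norm (\<eta> - \<xi>))"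
            using norm_triangle_le[of "F t ?y - F t ?x - F' t ?x (?y - ?x)" "F' t ?x (?y - ?x - ?z)"] 1 2
            by (smt (verit))
        qed (use K(1) \<open>0 < \<epsilon>'\<close> \<open>0 \<le> M\<close> in auto)
        also have "\<dots> = \<epsilon> * norm (\<eta> - \<xi>) * (M / (M + 1))"
          using \<open>0 \<le> M\<close> by (simp add: X(2) \<open>\<eta> \<in> U\<close> \<xi> Y(2) \<epsilon>'_def E_def[symmetric]) (simp add: E_def)
        also have "\<dots> \<le> \<epsilon> * norm (\<eta> - \<xi>)"
          using \<open>0 < \<epsilon>\<close> \<open>0 \<le> M\<close> by (intro mult_left_le) auto
        finally show ?thesis .
      qed
      moreover have "0 < d'" using tube(1) \<delta>'(1) d(1) \<open>0 \<le> M\<close> by (simp add: d'_def)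
      ultimately show "\<exists>d>0. \<forall>y. norm (y - \<xi>) < d \<longrightarrow>
          norm (X y t - X \<xi> t - Y t (y - \<xi>)) \<le> \<epsilon> * norm (y - \<xi>)" by blast
    qed
    with Y show ?thesis by blast
  qed
  then obtain Y where "\<forall>\<xi>\<in>U. (\<forall>t\<in>{0..b}. ((\<lambda>\<eta>. X \<eta> t) has_derivative Y \<xi> t) (at \<xi>)) \<and>
      (\<forall>v. solves b (\<lambda>t. F' t (X \<xi> t)) (\<lambda>t. Y \<xi> t v)) \<and> (\<forall>v. Y \<xi> 0 v = v)"
    by metis
  with that show ?thesis by blast
qed

section \<open>Third-order variations\<close>

text \<open>The tangent system. The direction of differentiation becomes part of the initial value,
  so that second-order differentiability of the original flow is first-order differentiability of
  this one.\<close>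

definition var_ext :: "(real \<Rightarrow> 'a::real_normed_vector \<Rightarrow> 'b::real_normed_vector) \<Rightarrow> (real \<Rightarrow> 'a \<Rightarrow> 'a \<Rightarrow> 'b) \<Rightarrow>
    real \<Rightarrow> 'a \<times> 'a \<Rightarrow> 'b \<times> 'b" where
  "var_ext F F' t z = (F t (fst z), F' t (fst z) (snd z))"

lemma solves_var_ext:
  assumes "solves b F x" "solves b (\<lambda>t. F' t (x t)) y"
  shows "solves b (var_ext F F') (\<lambda>t. (x t, y t))"
  using assms unfolding solves_def var_ext_def by (auto intro!: has_vector_derivative_Pair)

text \<open>\<open>Ak\<close> and \<open>Bk\<close> are the \<open>k\<close>-th differentials of \<open>\<xi> \<mapsto> X \<xi> t\<close> and of \<open>\<xi> \<mapsto> F t (X \<xi> t)\<close>. They come from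
  first-order differentiability of the flow, applied to \<open>F\<close>, to its variational system for the pair
  (state, variation), and to the variational system of that system.\<close>

theorem flow_third_order_variations:
  fixes F :: "real \<Rightarrow> 'a::euclidean_space \<Rightarrow> 'a"
  assumes C0: "C1x {0..b} F F'"
    and C1: "C1x {0..b} (var_ext F F') F1'"
    and C2: "C1x {0..b} (var_ext (var_ext F F') F1') F2'"
    and "0 \<le> b" and "open U"
    and X: "\<And>\<xi>. \<xi> \<in> U \<Longrightarrow> solves b F (X \<xi>)" "\<And>\<xi>. \<xi> \<in> U \<Longrightarrow> X \<xi> 0 = \<xi>"
  obtains A1 A2 A3 B1 B2 B3 where
    "\<And>\<xi> t. \<xi> \<in> U \<Longrightarrow> t \<in> {0..b} \<Longrightarrow> ((\<lambda>\<eta>. X \<eta> t) has_derivative A1 t \<xi>) (at \<xi>)"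
    "\<And>\<xi> t u. \<xi> \<in> U \<Longrightarrow> t \<in> {0..b} \<Longrightarrow> ((\<lambda>\<eta>. A1 t \<eta> u) has_derivative A2 t \<xi> u) (at \<xi>)"
    "\<And>\<xi> t u v. \<xi> \<in> U \<Longrightarrow> t \<in> {0..b} \<Longrightarrow> ((\<lambda>\<eta>. A2 t \<eta> u v) has_derivative A3 t \<xi> u v) (at \<xi>)"
    "\<And>\<xi> t. \<xi> \<in> U \<Longrightarrow> t \<in> {0..b} \<Longrightarrow> ((\<lambda>\<eta>. F t (X \<eta> t)) has_derivative B1 t \<xi>) (at \<xi>)"
    "\<And>\<xi> t u. \<xi> \<in> U \<Longrightarrow> t \<in> {0..b} \<Longrightarrow> ((\<lambda>\<eta>. B1 t \<eta> u) has_derivative B2 t \<xi> u) (at \<xi>)"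
    "\<And>\<xi> t u v. \<xi> \<in> U \<Longrightarrow> t \<in> {0..b} \<Longrightarrow> ((\<lambda>\<eta>. B2 t \<eta> u v) has_derivative B3 t \<xi> u v) (at \<xi>)"
    "\<And>\<xi> t u. \<xi> \<in> U \<Longrightarrow> t \<in> {0..b} \<Longrightarrow>
      ((\<lambda>t. A1 t \<xi> u) has_vector_derivative B1 t \<xi> u) (at t within {0..b})"
    "\<And>\<xi> t u v. \<xi> \<in> U \<Longrightarrow> t \<in> {0..b} \<Longrightarrow>
      ((\<lambda>t. A2 t \<xi> u v) has_vector_derivative B2 t \<xi> u v) (at t within {0..b})"
    "\<And>\<xi> t u v w. \<xi> \<in> U \<Longrightarrow> t \<in> {0..b} \<Longrightarrow>
      ((\<lambda>t. A3 t \<xi> u v w) has_vector_derivative B3 t \<xi> u v w) (at t within {0..b})"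
proof -
  obtain Y where Y: "\<And>\<xi> t. \<xi> \<in> U \<Longrightarrow> t \<in> {0..b} \<Longrightarrow> ((\<lambda>\<eta>. X \<eta> t) has_derivative Y \<xi> t) (at \<xi>)"
    "\<And>\<xi> v. \<xi> \<in> U \<Longrightarrow> solves b (\<lambda>t. F' t (X \<xi> t)) (\<lambda>t. Y \<xi> t v)"
    "\<And>\<xi> v. \<xi> \<in> U \<Longrightarrow> Y \<xi> 0 v = v"
    by (rule flow_differentiable[OF C0 \<open>0 \<le> b\<close> \<open>open U\<close> X]) blast+
  \<comment> \<open>Variations may start at any vector, so the enlarged initial values range over an
    open set and \<open>flow_differentiable\<close> applies again.\<close>
  define U1 where "U1 = U \<times> (UNIV :: 'a set)"
  define X1 where "X1 p t = (X (fst p) t, Y (fst p) t (snd p))" for p t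
  have "open U1" by (simp add: U1_def open_Times \<open>open U\<close>)
  have X1: "p \<in> U1 \<Longrightarrow> solves b (var_ext F F') (X1 p)" "p \<in> U1 \<Longrightarrow> X1 p 0 = p" for p
    unfolding U1_def X1_def by (auto intro!: solves_var_ext X Y)
  obtain Y1 where Y1: "\<And>\<xi> t. \<xi> \<in> U1 \<Longrightarrow> t \<in> {0..b} \<Longrightarrow> ((\<lambda>\<eta>. X1 \<eta> t) has_derivative Y1 \<xi> t) (at \<xi>)"
    "\<And>\<xi> v. \<xi> \<in> U1 \<Longrightarrow> solves b (\<lambda>t. F1' t (X1 \<xi> t)) (\<lambda>t. Y1 \<xi> t v)"
    "\<And>\<xi> v. \<xi> \<in> U1 \<Longrightarrow> Y1 \<xi> 0 v = v"
    by (rule flow_differentiable[OF C1 \<open>0 \<le> b\<close> \<open>open U1\<close> X1]) blast+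
  define U2 where "U2 = U1 \<times> (UNIV :: ('a \<times> 'a) set)"
  define X2 where "X2 p t = (X1 (fst p) t, Y1 (fst p) t (snd p))" for p t
  have "open U2" by (simp add: U2_def open_Times \<open>open U1\<close>)
  have X2: "p \<in> U2 \<Longrightarrow> solves b (var_ext (var_ext F F') F1') (X2 p)" "p \<in> U2 \<Longrightarrow> X2 p 0 = p" for p
    unfolding U2_def X2_def by (auto intro!: solves_var_ext X1 Y1)
  obtain Y2 where Y2: "\<And>\<xi> t. \<xi> \<in> U2 \<Longrightarrow> t \<in> {0..b} \<Longrightarrow> ((\<lambda>\<eta>. X2 \<eta> t) has_derivative Y2 \<xi> t) (at \<xi>)"
    "\<And>\<xi> v. \<xi> \<in> U2 \<Longrightarrow> solves b (\<lambda>t. F2' t (X2 \<xi> t)) (\<lambda>t. Y2 \<xi> t v)"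
    "\<And>\<xi> v. \<xi> \<in> U2 \<Longrightarrow> Y2 \<xi> 0 v = v"
    by (rule flow_differentiable[OF C2 \<open>0 \<le> b\<close> \<open>open U2\<close> X2]) blast+
  have U1: "(\<xi>, u) \<in> U1" if "\<xi> \<in> U" for \<xi> u using that by (simp add: U1_def)
  have U2: "((\<xi>, u), q) \<in> U2" if "\<xi> \<in> U" for \<xi> u q using that by (simp add: U1_def U2_def)
  have chain0: "((\<lambda>\<eta>. F t (X \<eta> t)) has_derivative (\<lambda>v. F' t (X \<xi> t) (Y \<xi> t v))) (at \<xi>)"
    if "\<xi> \<in> U" "t \<in> {0..b}" for \<xi> t
    by (rule has_derivative_compose[OF Y(1) C1x_has_derivative[OF C0]]) (use that in auto)
  have chain1: "((\<lambda>p. var_ext F F' t (X1 p t)) has_derivative (\<lambda>q. F1' t (X1 p t) (Y1 p t q))) (at p)"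
    if "p \<in> U1" "t \<in> {0..b}" for p t
    by (rule has_derivative_compose[OF Y1(1) C1x_has_derivative[OF C1]]) (use that in auto)
  have chain2: "((\<lambda>p. var_ext (var_ext F F') F1' t (X2 p t)) has_derivative (\<lambda>q. F2' t (X2 p t) (Y2 p t q))) (at p)"
    if "p \<in> U2" "t \<in> {0..b}" for p t
    by (rule has_derivative_compose[OF Y2(1) C1x_has_derivative[OF C2]]) (use that in auto)
  have in1: "((\<lambda>\<eta>. (\<eta>, u)) has_derivative (\<lambda>k. (k, 0))) (at \<xi>)" for \<xi> u :: 'a
    by (auto intro!: derivative_eq_intros)
  have in2: "((\<lambda>\<eta>. ((\<eta>, u), q)) has_derivative (\<lambda>k. ((k, 0), 0))) (at \<xi>)" for \<xi> u :: 'a and q :: "'a \<times> 'a"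
    by (auto intro!: derivative_eq_intros)
  show ?thesis
  \<comment> \<open>Differentiating in direction \<open>(v, 0)\<close> moves \<xi> along
    \<open>v\<close> and holds \<open>u\<close> fixed, so the second component is the derivative of
    \<open>Y \<xi> t u\<close> in \<xi>. In the same way \<open>((w, 0), 0)\<close> holds both
    \<open>u\<close> and \<open>(v, 0)\<close> fixed. The last three witnesses come from the
    right-hand sides by the chain rule.\<close>
  proof (rule that[of "\<lambda>t \<xi>. Y \<xi> t" "\<lambda>t \<xi> u v. snd (Y1 (\<xi>, u) t (v, 0))"
        "\<lambda>t \<xi> u v w. snd (snd (Y2 ((\<xi>, u), (v, 0)) t ((w, 0), 0)))"
        "\<lambda>t \<xi> u. F' t (X \<xi> t) (Y \<xi> t u)"
        "\<lambda>t \<xi> u v. snd (F1' t (X1 (\<xi>, u) t) (Y1 (\<xi>, u) t (v, 0)))"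
        "\<lambda>t \<xi> u v w. snd (snd (F2' t (X2 ((\<xi>, u), (v, 0)) t) (Y2 ((\<xi>, u), (v, 0)) t ((w, 0), 0))))"])
    fix \<xi> t assume "\<xi> \<in> U" "t \<in> {0..b}"
    note h = this
    show "((\<lambda>\<eta>. X \<eta> t) has_derivative Y \<xi> t) (at \<xi>)" by (rule Y(1)[OF h])
    show "((\<lambda>\<eta>. F t (X \<eta> t)) has_derivative (\<lambda>v. F' t (X \<xi> t) (Y \<xi> t v))) (at \<xi>)" by (rule chain0[OF h])
    fix u
    show "((\<lambda>\<eta>. Y \<eta> t u) has_derivative (\<lambda>v. snd (Y1 (\<xi>, u) t (v, 0)))) (at \<xi>)"
      using has_derivative_snd[OF has_derivative_compose[OF in1 Y1(1)[OF U1[OF h(1)] h(2)]]]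
      by (simp add: X1_def)
    show "((\<lambda>\<eta>. F' t (X \<eta> t) (Y \<eta> t u)) has_derivative
        (\<lambda>v. snd (F1' t (X1 (\<xi>, u) t) (Y1 (\<xi>, u) t (v, 0))))) (at \<xi>)"
      using has_derivative_snd[OF has_derivative_compose[OF in1 chain1[OF U1[OF h(1)] h(2)]]]
      by (simp add: X1_def var_ext_def)
    show "((\<lambda>t. Y \<xi> t u) has_vector_derivative F' t (X \<xi> t) (Y \<xi> t u)) (at t within {0..b})"
      by (rule solvesD[OF Y(2)[OF h(1)] h(2)])
    fix v
    show "((\<lambda>\<eta>. snd (Y1 (\<eta>, u) t (v, 0))) has_derivative
        (\<lambda>w. snd (snd (Y2 ((\<xi>, u), (v, 0)) t ((w, 0), 0))))) (at \<xi>)"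
      using has_derivative_snd[OF has_derivative_snd[OF has_derivative_compose[OF in2 Y2(1)[OF U2[OF h(1)] h(2)]]]]
      by (simp add: X2_def)
    show "((\<lambda>\<eta>. snd (F1' t (X1 (\<eta>, u) t) (Y1 (\<eta>, u) t (v, 0)))) has_derivative
        (\<lambda>w. snd (snd (F2' t (X2 ((\<xi>, u), (v, 0)) t) (Y2 ((\<xi>, u), (v, 0)) t ((w, 0), 0)))))) (at \<xi>)"
      using has_derivative_snd[OF has_derivative_snd[OF has_derivative_compose[OF in2 chain2[OF U2[OF h(1)] h(2)]]]]
      by (simp add: X2_def var_ext_def)
    show "((\<lambda>t. snd (Y1 (\<xi>, u) t (v, 0))) has_vector_derivative
        snd (F1' t (X1 (\<xi>, u) t) (Y1 (\<xi>, u) t (v, 0)))) (at t within {0..b})"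
      using bounded_linear.has_vector_derivative[OF bounded_linear_snd solvesD[OF Y1(2)[OF U1[OF h(1)]] h(2)]] .
    fix w
    show "((\<lambda>t. snd (snd (Y2 ((\<xi>, u), (v, 0)) t ((w, 0), 0)))) has_vector_derivative
        snd (snd (F2' t (X2 ((\<xi>, u), (v, 0)) t) (Y2 ((\<xi>, u), (v, 0)) t ((w, 0), 0))))) (at t within {0..b})"
      using bounded_linear.has_vector_derivative[OF bounded_linear_snd
          bounded_linear.has_vector_derivative[OF bounded_linear_snd solvesD[OF Y2(2)[OF U2[OF h(1)]] h(2)]]] .
  qed
qed

section \<open>Smoothness of the variational systems\<close>

lemma C1x_linear_compose:
  fixes F :: "real \<Rightarrow> 'b::real_normed_vector \<Rightarrow> 'c::real_normed_vector"
  assumes "C1x S F F'" "bounded_linear L"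
  shows "C1x S (\<lambda>t z. F t (L z)) (\<lambda>t z v. F' t (L z) (L v))"
proof -
  have cont: "continuous_on (S \<times> UNIV) (\<lambda>(t, z). G t (L z))"
    if "continuous_on (S \<times> UNIV) (\<lambda>(t, x). G t x)" for G :: "real \<Rightarrow> 'b \<Rightarrow> 'c"
  proof -
    have "continuous_on (S \<times> UNIV) (\<lambda>p. G (fst p) (L (snd p)))"
      by (rule continuous_on_compose_Pair[OF that])
        (auto intro!: continuous_intros bounded_linear.continuous_on[OF assms(2)])
    then show ?thesis by (simp add: case_prod_beta)
  qed
  have "((\<lambda>z. F t (L z)) has_derivative (\<lambda>v. F' t (L z) (L v))) (at z)" if "t \<in> S" for t z
    using has_derivative_compose[OF bounded_linear_imp_has_derivative[OF assms(2)] C1x_has_derivative[OF assms(1) that]] .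
  with assms(1) show ?thesis unfolding C1x_def by (auto intro!: cont)
qed

lemma C1x_scaleR:
  assumes C: "C1x S F F'" and l: "bounded_linear l"
  shows "C1x S (\<lambda>t z. l z *\<^sub>R F t z) (\<lambda>t z v. l z *\<^sub>R F' t z v + l v *\<^sub>R F t z)"
proof -
  have 1: "continuous_on (S \<times> UNIV) (\<lambda>p. F (fst p) (snd p))"
    "continuous_on (S \<times> UNIV) (\<lambda>p. F' (fst p) (snd p) v)" for v
    using C by (auto simp: C1x_def case_prod_beta)
  have 2: "continuous_on (S \<times> UNIV) (\<lambda>p. l (snd p))"
    by (intro bounded_linear.continuous_on[OF l] continuous_intros)
  have "((\<lambda>z. l z *\<^sub>R F t z) has_derivative (\<lambda>v. l z *\<^sub>R F' t z v + l v *\<^sub>R F t z)) (at z)"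
    if "t \<in> S" for t z
    by (intro has_derivative_scaleR bounded_linear_imp_has_derivative[OF l] C1x_has_derivative[OF C that])
  then show ?thesis unfolding C1x_def case_prod_beta by (auto intro!: continuous_intros 1 2)
qed

lemma C1x_add:
  assumes F: "C1x S F F'" and G: "C1x S G G'"
  shows "C1x S (\<lambda>t z. F t z + G t z) (\<lambda>t z v. F' t z v + G' t z v)"
  using assms unfolding C1x_def case_prod_beta by (auto intro!: continuous_intros has_derivative_add)

lemma C1x_Pair:
  assumes F: "C1x S F F'" and G: "C1x S G G'"
  shows "C1x S (\<lambda>t z. (F t z, G t z)) (\<lambda>t z v. (F' t z v, G' t z v))"
  using assms unfolding C1x_def case_prod_beta by (auto intro!: continuous_intros has_derivative_Pair)

lemma C1x_sum:
  assumes "\<And>i. i \<in> A \<Longrightarrow> C1x S (F i) (F' i)"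
  shows "C1x S (\<lambda>t z. \<Sum>i\<in>A. F i t z) (\<lambda>t z v. \<Sum>i\<in>A. F' i t z v)"
  using assms unfolding C1x_def case_prod_beta by (auto intro!: continuous_intros has_derivative_sum)

lemma bounded_linear_vec_nth_compose: "bounded_linear L \<Longrightarrow> bounded_linear (\<lambda>z. L z $ i)"
  by (rule bounded_linear_compose[OF bounded_linear_vec_nth])

text \<open>In coordinates, the variational systems are polynomial in the components of the
  variations, with coefficients \<open>p0\<close>, \<open>p1\<close>, \<open>p2\<close> evaluated at
  the base point. They are therefore as smooth as these coefficients, which is where three
  derivatives of \<open>f\<close> enter.\<close>

lemma C1x_var_ext_partials:
  fixes p0 :: "real \<Rightarrow> real ^ 'n::finite \<Rightarrow> 'b::real_normed_vector"
  assumes p0: "C1x S p0 (\<lambda>t x v. \<Sum>i\<in>UNIV. v $ i *\<^sub>R p1 i t x)"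
    and p1: "\<And>i. C1x S (p1 i) (\<lambda>t x v. \<Sum>j\<in>UNIV. v $ j *\<^sub>R p2 i j t x)"
    and p2: "\<And>i j. C1x S (p2 i j) (q i j)"
  obtains F1' F2' where "C1x S (var_ext p0 (\<lambda>t x v. \<Sum>i\<in>UNIV. v $ i *\<^sub>R p1 i t x)) F1'"
    "C1x S (var_ext (var_ext p0 (\<lambda>t x v. \<Sum>i\<in>UNIV. v $ i *\<^sub>R p1 i t x)) F1') F2'"
proof -
  let ?F' = "\<lambda>t x v. \<Sum>i\<in>UNIV. v $ i *\<^sub>R p1 i t x"
  define F1' where "F1' t z v = ((\<Sum>i\<in>UNIV. fst v $ i *\<^sub>R p1 i t (fst z)),
      \<Sum>i\<in>UNIV. snd z $ i *\<^sub>R (\<Sum>j\<in>UNIV. fst v $ j *\<^sub>R p2 i j t (fst z)) + snd v $ i *\<^sub>R p1 i t (fst z))"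
    for t z v
  note bl = bounded_linear_fst bounded_linear_snd bounded_linear_fst_comp bounded_linear_snd_comp
    bounded_linear_vec_nth_compose
  have 1: "C1x S (var_ext p0 ?F') F1'"
    unfolding var_ext_def F1'_def
    by (intro C1x_Pair C1x_sum C1x_scaleR C1x_linear_compose[OF p0] C1x_linear_compose[OF p1] bl)
  \<comment> \<open>\<open>F1'\<close> must be explicit because it reappears inside the second
    extension. Of \<open>F2'\<close> only the existence matters, and \<open>sm\<close> records just
    that.\<close>
  define sm where "sm F \<longleftrightarrow> (\<exists>F'. C1x S F F')" for F :: "real \<Rightarrow> ((real ^ 'n) \<times> (real ^ 'n)) \<times> ((real ^ 'n) \<times> (real ^ 'n)) \<Rightarrow> 'b"
  have sm_add: "sm F \<Longrightarrow> sm G \<Longrightarrow> sm (\<lambda>t z. F t z + G t z)" for F G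
    unfolding sm_def using C1x_add by blast
  have sm_scale: "bounded_linear l \<Longrightarrow> sm F \<Longrightarrow> sm (\<lambda>t z. l z *\<^sub>R F t z)" for l F
    unfolding sm_def using C1x_scaleR by blast
  have sm_sum: "(\<And>i. sm (G i)) \<Longrightarrow> sm (\<lambda>t z. \<Sum>i\<in>UNIV. G i t z)" for G :: "'n \<Rightarrow> _"
    unfolding sm_def using C1x_sum[of UNIV S G] by metis
  have sm_p: "sm (\<lambda>t z. p1 i t (fst (fst z)))" "sm (\<lambda>t z. p2 i j t (fst (fst z)))" for i j
    unfolding sm_def using C1x_linear_compose[OF p1] C1x_linear_compose[OF p2] bounded_linear_fst_comp[OF bounded_linear_fst]
    by blast+
  have "sm (\<lambda>t z. \<Sum>i\<in>UNIV. fst (snd z) $ i *\<^sub>R p1 i t (fst (fst z)))"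
    by (intro sm_sum sm_scale sm_p bl)
  moreover have "sm (\<lambda>t z. \<Sum>i\<in>UNIV. snd (fst z) $ i *\<^sub>R (\<Sum>j\<in>UNIV. fst (snd z) $ j *\<^sub>R p2 i j t (fst (fst z)))
      + snd (snd z) $ i *\<^sub>R p1 i t (fst (fst z)))"
    by (intro sm_sum sm_add sm_scale sm_p bl)
  ultimately obtain G G' where
    "C1x S (\<lambda>t (z :: ((real ^ 'n) \<times> (real ^ 'n)) \<times> ((real ^ 'n) \<times> (real ^ 'n))).
      \<Sum>i\<in>UNIV. fst (snd z) $ i *\<^sub>R p1 i t (fst (fst z))) G"
    "C1x S (\<lambda>t (z :: ((real ^ 'n) \<times> (real ^ 'n)) \<times> ((real ^ 'n) \<times> (real ^ 'n))).
      \<Sum>i\<in>UNIV. snd (fst z) $ i *\<^sub>R (\<Sum>j\<in>UNIV. fst (snd z) $ j *\<^sub>R p2 i j t (fst (fst z)))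
      + snd (snd z) $ i *\<^sub>R p1 i t (fst (fst z))) G'"
    unfolding sm_def by blast
  from C1x_Pair[OF C1x_linear_compose[OF 1 bounded_linear_fst] C1x_Pair[OF this]]
  have "\<exists>F2'. C1x S (var_ext (var_ext p0 ?F') F1') F2'" unfolding var_ext_def[of "var_ext p0 ?F'"] F1'_def by blast
  with 1 that show ?thesis by blast
qed

section \<open>From partial derivatives to total derivatives\<close>

text \<open>The path from \<open>x\<close> to \<open>y\<close> is taken one coordinate at a time. On
  each piece the mean value inequality compares the increment with \<open>p i x\<close>, since
  \<open>p i\<close> stays close to that value near \<open>x\<close>.\<close>

lemma has_derivative_from_partials:
  fixes g :: "real ^ 'n::finite \<Rightarrow> 'b::real_normed_vector"
  assumes p: "\<And>i y. ((\<lambda>s. g (y + s *\<^sub>R axis i 1)) has_vector_derivative p i y) (at 0)"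
    and cont: "\<And>i. continuous (at x) (p i)"
  shows "(g has_derivative (\<lambda>v. \<Sum>i\<in>UNIV. v $ i *\<^sub>R p i x)) (at x)"
proof -
  have bl: "bounded_linear (\<lambda>v. \<Sum>i\<in>UNIV. v $ i *\<^sub>R p i x)"
    by (intro bounded_linear_sum bounded_linear_scaleR_const bounded_linear_vec_nth)
  \<comment> \<open>The hypothesis speaks about \<open>s = 0\<close> only; moving the base point
    along the line gives the derivative at every \<open>s\<close>.\<close>
  have line: "((\<lambda>s. g (y + s *\<^sub>R axis i 1)) has_vector_derivative p i (y + s *\<^sub>R axis i 1)) (at s)" for y i s
  proof -
    have "((\<lambda>r. g ((y + s *\<^sub>R axis i 1) + r *\<^sub>R axis i 1)) has_vector_derivative p i (y + s *\<^sub>R axis i 1)) (at (s - s))"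
      using p[of "y + s *\<^sub>R axis i 1" i] by simp
    note vector_diff_chain_at[where f = "\<lambda>r. r - s" and x = s and f' = 1, OF _ this]
    moreover have "((\<lambda>r. r - s) has_vector_derivative 1) (at s)"
      by (auto intro!: derivative_eq_intros simp: has_real_derivative_iff_has_vector_derivative[symmetric])
    ultimately show ?thesis by (simp add: o_def algebra_simps)
  qed
  show ?thesis
    unfolding has_derivative_at_alt
  proof (intro conjI allI impI bl)
    fix e :: real assume "0 < e"
    define N where "N = real CARD('n)"
    have "0 < N" by (simp add: N_def)
    define \<epsilon> where "\<epsilon> = e / N"
    have "0 < \<epsilon>" using \<open>0 < e\<close> \<open>0 < N\<close> by (simp add: \<epsilon>_def)
    have "\<forall>i. \<exists>d>0. \<forall>y. dist y x < d \<longrightarrow> dist (p i y) (p i x) < \<epsilon>"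
      using cont \<open>0 < \<epsilon>\<close> by (simp add: continuous_at_eps_delta)
    then obtain d where d: "\<And>i. 0 < d i" "\<And>i y. dist y x < d i \<Longrightarrow> dist (p i y) (p i x) < \<epsilon>" by metis
    \<comment> \<open>The norm is at most the sum of the \<open>N\<close> coordinate moduli, so a
      box of half-width \<open>d0\<close> lies in every ball of radius \<open>d i\<close>. A box is
      used because the corners of the coordinatewise path stay in it.\<close>
    define d0 where "d0 = Min (range d) / N"
    have "0 < d0" using d(1) \<open>0 < N\<close> by (simp add: d0_def Min_gr_iff)
    define box where "box y \<longleftrightarrow> (\<forall>i. \<bar>y $ i - x $ i\<bar> < d0)" for y :: "real ^ 'n"
    have box: "norm (p i y - p i x) \<le> \<epsilon>" if "box y" for y i
    proof -
      have "dist y x \<le> (\<Sum>i\<in>UNIV. \<bar>(y - x) $ i\<bar>)" unfolding dist_norm by (rule norm_le_l1_cart)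
      also have "\<dots> < (\<Sum>i\<in>(UNIV :: 'n set). d0)" using that by (intro sum_strict_mono) (auto simp: box_def)
      also have "\<dots> = Min (range d)" using \<open>0 < N\<close> by (simp add: d0_def N_def)
      also have "\<dots> \<le> d i" by simp
      finally show ?thesis using d(2)[of y i] by (simp add: dist_norm)
    qed
    have step: "norm (g (y + a *\<^sub>R axis i 1) - g y - a *\<^sub>R p i x) \<le> \<epsilon> * \<bar>a\<bar>"
      if "box y" "box (y + a *\<^sub>R axis i 1)" for y a i
    proof -
      define G where "G s = g (y + s *\<^sub>R axis i 1) - s *\<^sub>R p i x" for s
      have seg: "box (y + s *\<^sub>R axis i 1)" if s: "s \<in> closed_segment 0 a" for s
      proof -
        have "\<bar>y $ i + s - x $ i\<bar> < d0"
        proof -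
          have "\<bar>y $ i - x $ i\<bar> < d0" "\<bar>y $ i + a - x $ i\<bar> < d0"
            using \<open>box y\<close>[unfolded box_def, rule_format, of i]
              \<open>box (y + a *\<^sub>R axis i 1)\<close>[unfolded box_def, rule_format, of i]
            by (simp_all add: axis_def)
          then show ?thesis using s by (auto simp: closed_segment_eq_real_ivl split: if_splits)
        qed
        then show ?thesis using \<open>box y\<close> unfolding box_def by (auto simp: axis_def)
      qed
      have "norm (G a - G 0) \<le> \<epsilon> * norm (a - 0)"
      proof (rule differentiable_bound[where S = "closed_segment 0 a" and f' = "\<lambda>s h. h *\<^sub>R (p i (y + s *\<^sub>R axis i 1) - p i x)"])
        fix s assume s: "s \<in> closed_segment 0 a"
        have "(G has_vector_derivative p i (y + s *\<^sub>R axis i 1) - p i x) (at s)"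
          unfolding G_def using line[of y i s] by (auto intro!: derivative_eq_intros)
        then show "(G has_derivative (\<lambda>h. h *\<^sub>R (p i (y + s *\<^sub>R axis i 1) - p i x))) (at s within closed_segment 0 a)"
          unfolding has_vector_derivative_def by (rule has_derivative_at_withinI)
        show "onorm (\<lambda>h. h *\<^sub>R (p i (y + s *\<^sub>R axis i 1) - p i x)) \<le> \<epsilon>"
          using box[OF seg[OF s], of i] by (intro onorm_le) (simp add: mult.commute[of \<epsilon>] mult_left_mono)
      qed auto
      then show ?thesis by (simp add: G_def algebra_simps)
    qed
    \<comment> \<open>Induction on the set of coordinates in which \<open>y\<close> and
      \<open>z\<close> may differ: \<open>w\<close> agrees with \<open>z\<close> in one more
      coordinate, and the increments telescope.\<close>
    have "norm (g y - g z - (\<Sum>i\<in>A. (y $ i - z $ i) *\<^sub>R p i x)) \<le> \<epsilon> * (\<Sum>i\<in>A. \<bar>y $ i - z $ i\<bar>)"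
      if "finite A" "box y" "box z" "\<And>j. j \<notin> A \<Longrightarrow> y $ j = z $ j" for A y z
      using that
    proof (induction A arbitrary: y rule: finite_induct)
      case empty
      then have "y = z" by (simp add: vec_eq_iff)
      then show ?case by simp
    next
      case (insert i A)
      define w where "w = y + (z $ i - y $ i) *\<^sub>R axis i 1"
      have w: "w $ j = (if j = i then z $ i else y $ j)" for j by (simp add: w_def axis_def)
      have y: "y = w + (y $ i - z $ i) *\<^sub>R axis i 1" by (simp add: w_def algebra_simps)
      have "box w" using insert.prems by (auto simp: box_def w)
      have "norm (g w - g z - (\<Sum>j\<in>A. (w $ j - z $ j) *\<^sub>R p j x)) \<le> \<epsilon> * (\<Sum>j\<in>A. \<bar>w $ j - z $ j\<bar>)"
        using insert.prems by (intro insert.IH \<open>box w\<close>) (auto simp: w)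
      moreover have "(\<Sum>j\<in>A. (w $ j - z $ j) *\<^sub>R p j x) = (\<Sum>j\<in>A. (y $ j - z $ j) *\<^sub>R p j x)"
        "(\<Sum>j\<in>A. \<bar>w $ j - z $ j\<bar>) = (\<Sum>j\<in>A. \<bar>y $ j - z $ j\<bar>)"
        using insert.hyps by (auto intro!: sum.cong simp: w)
      moreover have "norm (g y - g w - (y $ i - z $ i) *\<^sub>R p i x) \<le> \<epsilon> * \<bar>y $ i - z $ i\<bar>"
        using step[of w "y $ i - z $ i" i] \<open>box w\<close> insert.prems(1) y by simp
      ultimately have "norm ((g y - g w - (y $ i - z $ i) *\<^sub>R p i x) + (g w - g z - (\<Sum>j\<in>A. (y $ j - z $ j) *\<^sub>R p j x)))
          \<le> \<epsilon> * \<bar>y $ i - z $ i\<bar> + \<epsilon> * (\<Sum>j\<in>A. \<bar>y $ j - z $ j\<bar>)"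
        by (intro norm_triangle_le add_mono) auto
      then show ?case using insert.hyps by (simp add: algebra_simps)
    qed
    note tele = this[of UNIV _ x]
    have "norm (g y - g x - (\<Sum>i\<in>UNIV. (y - x) $ i *\<^sub>R p i x)) \<le> e * norm (y - x)" if "norm (y - x) < d0" for y
    proof -
      have "box y" unfolding box_def
        using component_le_norm_cart[of "y - x"] that by (auto intro: le_less_trans)
      have "norm (g y - g x - (\<Sum>i\<in>UNIV. (y - x) $ i *\<^sub>R p i x)) \<le> \<epsilon> * (\<Sum>i\<in>UNIV. \<bar>(y - x) $ i\<bar>)"
        using tele[OF _ \<open>box y\<close>] \<open>0 < d0\<close> by (simp add: box_def)
      also have "\<dots> \<le> \<epsilon> * (\<Sum>i\<in>(UNIV :: 'n set). norm (y - x))"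
        using \<open>0 < \<epsilon>\<close> by (intro mult_left_mono sum_mono component_le_norm_cart) auto
      also have "\<dots> = e * norm (y - x)" using \<open>0 < N\<close> by (simp add: \<epsilon>_def N_def)
      finally show ?thesis .
    qed
    with \<open>0 < d0\<close> show "\<exists>d>0. \<forall>y. norm (y - x) < d \<longrightarrow>
        norm (g y - g x - (\<Sum>i\<in>UNIV. (y - x) $ i *\<^sub>R p i x)) \<le> e * norm (y - x)" by blast
  qed
qed

lemma C_in_x_continuous_on: "C_in_x k I f \<Longrightarrow> continuous_on (I \<times> UNIV) (\<lambda>(t, x). f t x)"
  by (cases k) auto

lemma C_in_x_partial_deriv: "C_in_x (Suc k) I f \<Longrightarrow> C_in_x k I (\<lambda>t. partial_deriv i (f t))"
  by simp

lemma C_in_x_has_derivative: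
  fixes f :: "real \<Rightarrow> real ^ 'n::finite \<Rightarrow> 'b::real_normed_vector"
  assumes "C_in_x (Suc k) I f" "t \<in> I"
  shows "(f t has_derivative (\<lambda>v. \<Sum>i\<in>UNIV. v $ i *\<^sub>R partial_deriv i (f t) x)) (at x)"
proof (rule has_derivative_from_partials)
  fix i y
  show "((\<lambda>s. f t (y + s *\<^sub>R axis i 1)) has_vector_derivative partial_deriv i (f t) y) (at 0)"
    using assms by (simp add: partial_deriv_def vector_derivative_works[symmetric])
  have "continuous_on UNIV (\<lambda>x. partial_deriv i (f t) x)"
    by (rule continuous_on_compose_Pair[OF C_in_x_continuous_on[OF C_in_x_partial_deriv[OF assms(1)]],
          where g = "\<lambda>_. t"]) (use assms in auto)
  then show "continuous (at x) (partial_deriv i (f t))"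
    by (simp add: continuous_on_eq_continuous_at)
qed

text \<open>\<open>g\<close> and \<open>c\<close> are there for the time change
  \<open>s \<mapsto> \<tau> + s * T\<close>, under which the right-hand side acquires the factor
  \<open>T\<close>. The derivative is written through partial derivatives in the form that
  \<open>C1x_var_ext_partials\<close> takes as input.\<close>

lemma C_in_x_C1x:
  fixes f :: "real \<Rightarrow> real ^ 'n::finite \<Rightarrow> 'b::real_normed_vector"
  assumes C: "C_in_x (Suc k) I f" and g: "continuous_on S g" "g ` S \<subseteq> I"
  shows "C1x S (\<lambda>s x. c *\<^sub>R f (g s) x) (\<lambda>s x v. \<Sum>i\<in>UNIV. v $ i *\<^sub>R (c *\<^sub>R partial_deriv i (f (g s)) x))"
proof -
  have cont: "continuous_on (S \<times> UNIV) (\<lambda>p. F (g (fst p)) (snd p))"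
    if "continuous_on (I \<times> UNIV) (\<lambda>(t, x). F t x)" for F :: "real \<Rightarrow> real ^ 'n \<Rightarrow> 'b"
    by (rule continuous_on_compose_Pair[OF that])
      (use g in \<open>auto intro!: continuous_intros continuous_on_compose2[OF g(1)]\<close>)
  have "((\<lambda>x. c *\<^sub>R f (g s) x) has_derivative (\<lambda>v. \<Sum>i\<in>UNIV. v $ i *\<^sub>R (c *\<^sub>R partial_deriv i (f (g s)) x))) (at x)"
    if "s \<in> S" for s x
  proof -
    have "g s \<in> I" using that g by auto
    from has_derivative_scaleR_right[OF C_in_x_has_derivative[OF C this], of c x]
    show ?thesis by (simp add: scaleR_sum_right mult.commute)
  qed
  then show ?thesis
    unfolding C1x_def case_prod_beta
    by (intro conjI ballI allI continuous_intros cont[OF C_in_x_continuous_on[OF C]]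
        cont[OF C_in_x_continuous_on[OF C_in_x_partial_deriv[OF C]]]) auto
qed

section \<open>Iterated differentials and maximal solutions\<close>

text \<open>Used to read \<open>D2\<close> and \<open>D3\<close> off from directional derivatives,
  one column \<open>H p\<close> at a time. The formula for \<open>G\<close> is required only near
  \<open>x\<close>, because the derivatives of the flow are described only on a
  neighbourhood.\<close>

lemma partial_deriv_matrix:
  fixes G :: "real ^ 'n::finite \<Rightarrow> real ^ 'c::finite ^ 'r::finite"
  assumes "open U" "x \<in> U" and G: "\<And>y. y \<in> U \<Longrightarrow> G y = (\<chi> r p. H p y $ r)"
    and H: "\<And>p. (H p has_derivative H' p) (at x)"
  shows "partial_deriv i G x = (\<chi> r p. H' p (axis i 1) $ r)"
proof -
  let ?l = "\<lambda>s. x + s *\<^sub>R axis i 1"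
  have l: "(?l has_derivative (\<lambda>s. s *\<^sub>R axis i 1)) (at 0)" by (auto intro!: derivative_eq_intros)
  have "((\<lambda>s. H p (?l s)) has_derivative (\<lambda>s. s *\<^sub>R H' p (axis i 1))) (at 0)" for p
    using has_derivative_compose[OF l, of "H p" "H' p"] H
    by (simp add: linear_cmul[OF has_derivative_linear[OF H]])
  then have "((\<lambda>s. H p (?l s) $ r) has_derivative (\<lambda>s. s * H' p (axis i 1) $ r)) (at 0)" for p r
    using bounded_linear.has_derivative[OF bounded_linear_vec_nth, of "\<lambda>s. H p (?l s)" _ _ r] by fastforce
  then have "((\<lambda>s. (\<chi> r p. H p (?l s) $ r)) has_vector_derivative (\<chi> r p. H' p (axis i 1) $ r)) (at 0)"
    unfolding has_vector_derivative_def
    by (subst has_derivative_componentwise_within) (auto simp: Basis_vec_def inner_axis)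
  moreover have "open (?l -` U)" using \<open>open U\<close> by (intro open_vimage continuous_intros)
  ultimately have "((\<lambda>s. G (?l s)) has_vector_derivative (\<chi> r p. H' p (axis i 1) $ r)) (at 0)"
    by (rule has_vector_derivative_transform_within_open) (use G \<open>x \<in> U\<close> in auto)
  then show ?thesis unfolding partial_deriv_def by (rule vector_derivative_at)
qed

lemma linear_vec_expansion:
  fixes L :: "real ^ 'n::finite \<Rightarrow> 'b::real_vector"
  assumes "linear L"
  shows "L v = (\<Sum>i\<in>UNIV. v $ i *\<^sub>R L (axis i 1))"
proof -
  have "L v = L (\<Sum>i\<in>UNIV. v $ i *\<^sub>R axis i 1)"
    using basis_expansion[of v] by (simp add: scalar_mult_eq_scaleR)
  then show ?thesis by (simp add: linear_sum[OF assms] linear_scale[OF assms] o_def)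
qed

text \<open>A derivative is linear in its last argument by definition. Linearity in the earlier
  arguments is inherited from the differentiated map through uniqueness of derivatives.\<close>

lemma derivative_vec_expansion:
  fixes P :: "real ^ 'n::finite \<Rightarrow> 'a::real_normed_vector \<Rightarrow> 'b::real_normed_vector"
  assumes "open U" "x \<in> U" and P: "\<And>y. y \<in> U \<Longrightarrow> P u y = (\<Sum>i\<in>UNIV. u $ i *\<^sub>R P (axis i 1) y)"
    and P': "\<And>u. (P u has_derivative P' u) (at x)"
  shows "P' u v = (\<Sum>i\<in>UNIV. u $ i *\<^sub>R P' (axis i 1) v)"
proof -
  have "((\<lambda>y. \<Sum>i\<in>UNIV. u $ i *\<^sub>R P (axis i 1) y) has_derivative (\<lambda>v. \<Sum>i\<in>UNIV. u $ i *\<^sub>R P' (axis i 1) v)) (at x)"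
    by (intro has_derivative_sum has_derivative_scaleR_right P')
  then have "(P u has_derivative (\<lambda>v. \<Sum>i\<in>UNIV. u $ i *\<^sub>R P' (axis i 1) v)) (at x)"
    by (rule has_derivative_transform_within_open[OF _ assms(1,2)]) (simp add: P)
  from has_derivative_unique[OF P' this] show ?thesis by metis
qed

text \<open>Links the block matrices to multilinear forms. Each \<open>block_D\<close> puts the
  newest direction first in the column index while \<open>g2\<close> and \<open>g3\<close> take it
  last, hence the reversed order of the basis vectors below. Expanding every argument in the basis
  produces the coefficients of the Kronecker powers of \<open>h\<close>.\<close>

lemma iterated_differentials:
  fixes g :: "real ^ 'n::finite \<Rightarrow> real ^ 'm::finite"
  assumes "open U"
    and g1: "\<And>x. x \<in> U \<Longrightarrow> (g has_derivative g1 x) (at x)"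
    and g2: "\<And>x u. x \<in> U \<Longrightarrow> ((\<lambda>x. g1 x u) has_derivative g2 x u) (at x)"
    and g3: "\<And>x u v. x \<in> U \<Longrightarrow> ((\<lambda>x. g2 x u v) has_derivative g3 x u v) (at x)"
    and "x \<in> U"
  shows "D1 g x *v h = g1 x h"
    and "D2 g x *v (h \<otimes> h) = g2 x h h"
    and "D3 g x *v (h \<otimes> h \<otimes> h) = g3 x h h h"
proof -
  let ?e = "\<lambda>i. axis i 1 :: real ^ 'n"
  have D1: "D1 g y = (\<chi> r j. g1 y (?e j) $ r)" if "y \<in> U" for y
    unfolding D1_def jacobian_def frechet_derivative_at[OF g1[OF that], symmetric] by (simp add: matrix_def)
  have D2: "D2 g y = (\<chi> r p. g2 y (?e (snd p)) (?e (fst p)) $ r)" if "y \<in> U" for y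
  proof -
    have "partial_deriv i (D1 g) y = (\<chi> r j. g2 y (?e j) (?e i) $ r)" for i
      by (rule partial_deriv_matrix[OF \<open>open U\<close> that, where H = "\<lambda>j y. g1 y (?e j)"]) (simp_all add: D1 g2[OF that])
    then show ?thesis by (simp add: D2_def block_D_def)
  qed
  have D3: "D3 g y = (\<chi> r p. g3 y (?e (snd (snd p))) (?e (fst (snd p))) (?e (fst p)) $ r)" if "y \<in> U" for y
  proof -
    have "partial_deriv i (D2 g) y = (\<chi> r p. g3 y (?e (snd p)) (?e (fst p)) (?e i) $ r)" for i
      by (rule partial_deriv_matrix[OF \<open>open U\<close> that, where H = "\<lambda>p y. g2 y (?e (snd p)) (?e (fst p))"])
        (simp_all add: D2 g3[OF that])
    then show ?thesis by (simp add: D3_def block_D_def)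
  qed
  have lin1: "g1 y u = (\<Sum>j\<in>UNIV. u $ j *\<^sub>R g1 y (?e j))" if "y \<in> U" for y u
    by (rule linear_vec_expansion[OF has_derivative_linear[OF g1[OF that]]])
  have lin2: "g2 y u v = (\<Sum>i\<in>UNIV. v $ i *\<^sub>R g2 y u (?e i))" if "y \<in> U" for y u v
    by (rule linear_vec_expansion[OF has_derivative_linear[OF g2[OF that]]])
  have lin2': "g2 y u v = (\<Sum>j\<in>UNIV. u $ j *\<^sub>R g2 y (?e j) v)" if "y \<in> U" for y u v
    by (rule derivative_vec_expansion[OF \<open>open U\<close> that, where P = "\<lambda>u y. g1 y u"]) (simp_all only: lin1[symmetric] g2[OF that])
  have lin3: "g3 y u v w = (\<Sum>i\<in>UNIV. w $ i *\<^sub>R g3 y u v (?e i))" if "y \<in> U" for y u v w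
    by (rule linear_vec_expansion[OF has_derivative_linear[OF g3[OF that]]])
  have lin3': "g3 y u v w = (\<Sum>j\<in>UNIV. v $ j *\<^sub>R g3 y u (?e j) w)" if "y \<in> U" for y u v w
    by (rule derivative_vec_expansion[OF \<open>open U\<close> that, where P = "\<lambda>v y. g2 y u v"]) (simp_all only: lin2[symmetric] g3[OF that])
  have lin3'': "g3 y u v w = (\<Sum>k\<in>UNIV. u $ k *\<^sub>R g3 y (?e k) v w)" if "y \<in> U" for y u v w
    by (rule derivative_vec_expansion[OF \<open>open U\<close> that, where P = "\<lambda>u y. g2 y u v"]) (simp_all only: lin2'[symmetric] g3[OF that])
  show "D1 g x *v h = g1 x h"
    unfolding lin1[OF \<open>x \<in> U\<close>, of h]
    by (simp add: vec_eq_iff D1[OF \<open>x \<in> U\<close>] matrix_vector_mult_def mult.commute)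
  have e2: "g2 x h h = (\<Sum>i\<in>UNIV. \<Sum>j\<in>UNIV. (h $ i * h $ j) *\<^sub>R g2 x (?e j) (?e i))"
    by (subst lin2[OF \<open>x \<in> U\<close>], subst lin2'[OF \<open>x \<in> U\<close>]) (simp add: scaleR_sum_right)
  show "D2 g x *v (h \<otimes> h) = g2 x h h"
    unfolding e2
    by (simp add: vec_eq_iff D2[OF \<open>x \<in> U\<close>] matrix_vector_mult_def kronecker_def mult.commute
        sum.cartesian_product case_prod_beta)
  have e3: "g3 x h h h = (\<Sum>i\<in>UNIV. \<Sum>j\<in>UNIV. \<Sum>k\<in>UNIV. (h $ i * (h $ j * h $ k)) *\<^sub>R g3 x (?e k) (?e j) (?e i))"
    by (subst lin3[OF \<open>x \<in> U\<close>], subst lin3'[OF \<open>x \<in> U\<close>], subst lin3''[OF \<open>x \<in> U\<close>]) (simp add: scaleR_sum_right)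
  show "D3 g x *v (h \<otimes> h \<otimes> h) = g3 x h h h"
    unfolding e3
    by (simp add: vec_eq_iff D3[OF \<open>x \<in> U\<close>] matrix_vector_mult_def kronecker_def mult.commute
        sum.cartesian_product case_prod_beta)
qed

section \<open>Rescaled time and maximal solutions\<close>

text \<open>A negative \<open>T\<close> turns a solution to the left of \<open>\<tau>\<close> into one on \<open>[0, 1]\<close>.\<close>

definition rescaled :: "(real \<Rightarrow> 'a::real_normed_vector \<Rightarrow> 'a) \<Rightarrow> real \<Rightarrow> real \<Rightarrow> real \<Rightarrow> 'a \<Rightarrow> 'a" where
  "rescaled f \<tau> T s x = T *\<^sub>R f (\<tau> + s * T) x"

lemma solves_mono: "solves b F x \<Longrightarrow> c \<le> b \<Longrightarrow> solves c F x"
  unfolding solves_def by (meson atLeastatMost_subset_iff has_vector_derivative_within_subset order_refl subsetD)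

lemma ivp_solution_rescaled:
  assumes x: "ivp_solution I f \<tau> \<xi> J x" and "\<And>s. s \<in> {0..b} \<Longrightarrow> \<tau> + s * T \<in> J"
  shows "solves b (rescaled f \<tau> T) (\<lambda>s. x (\<tau> + s * T))"
  unfolding solves_def
proof
  fix s assume s: "s \<in> {0..b}"
  have "((\<lambda>s. \<tau> + s * T) has_vector_derivative T) (at s within {0..b})"
    by (auto intro!: derivative_eq_intros simp: has_real_derivative_iff_has_vector_derivative[symmetric])
  moreover have "(x has_vector_derivative f (\<tau> + s * T) (x (\<tau> + s * T)))
      (at (\<tau> + s * T) within (\<lambda>s. \<tau> + s * T) ` {0..b})"
    using x assms(2)[OF s] by (auto simp: ivp_solution_def intro: has_vector_derivative_at_within)
  ultimately show "((\<lambda>s. x (\<tau> + s * T)) has_vector_derivative rescaled f \<tau> T s (x (\<tau> + s * T))) (at s within {0..b})"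
    using vector_diff_chain_within by (fastforce simp: o_def rescaled_def)
qed

lemma rescaled_segment:
  fixes \<tau> r s T :: real
  assumes "is_interval J" "\<tau> \<in> J" "\<tau> + s * T \<in> J" "0 \<le> r" "r \<le> s"
  shows "\<tau> + r * T \<in> J"
proof -
  have "\<tau> + r * T \<in> closed_segment \<tau> (\<tau> + s * T)"
  proof (cases "s = 0")
    case True
    then have "r = 0" using assms by simp
    then show ?thesis by simp
  next
    case False
    then have "\<tau> + r * T = (1 - r / s) *\<^sub>R \<tau> + (r / s) *\<^sub>R (\<tau> + s * T)" by (simp add: field_simps)
    moreover have "0 \<le> r / s" "r / s \<le> 1" using assms False by (auto simp: field_simps)
    ultimately show ?thesis unfolding closed_segment_def by blast
  qed
  moreover have "closed_segment \<tau> (\<tau> + s * T) \<subseteq> J"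
    using assms by (simp add: closed_segment_subset is_interval_convex)
  ultimately show ?thesis by blast
qed

text \<open>The union of \<open>J\<close> with the open segment from \<open>\<tau>\<close> to \<open>\<tau> + T\<close> carries a solution without any gluing
  at an endpoint, because the two solutions agree on the overlap.\<close>

lemma maximal_solution_contains:
  fixes f :: "real \<Rightarrow> real ^ 'n::finite \<Rightarrow> real ^ 'n"
  assumes max: "maximal_ivp_solution I f \<tau> \<eta> J x"
    and C: "C1x {0..1} (rescaled f \<tau> T) F'"
    and I: "\<And>s. s \<in> {0..1} \<Longrightarrow> \<tau> + s * T \<in> I"
    and y: "solves 1 (rescaled f \<tau> T) y" "y 0 = \<eta>" and "T \<noteq> 0"
    and s: "s \<in> {0..<1}"
  shows "\<tau> + s * T \<in> J" and "x (\<tau> + s * T) = y s"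
proof -
  have sol: "ivp_solution I f \<tau> \<eta> J x" using max by (simp add: maximal_ivp_solution_def)
  then have J: "open J" "is_interval J" "J \<subseteq> I" "\<tau> \<in> J" "x \<tau> = \<eta>"
    and x': "\<And>t. t \<in> J \<Longrightarrow> (x has_vector_derivative f t (x t)) (at t)"
    by (auto simp: ivp_solution_def)
  have agree: "x (\<tau> + s * T) = y s" if "s \<in> {0..<1}" "\<tau> + s * T \<in> J" for s
  proof (rule solves_unique[of s "rescaled f \<tau> T" F' "\<lambda>s. x (\<tau> + s * T)"])
    show "C1x {0..s} (rescaled f \<tau> T) F'"
    proof -
      have "{0..s} \<times> UNIV \<subseteq> {0..1} \<times> (UNIV :: (real ^ 'n) set)" using that by auto
      with C show ?thesis using that by (auto simp: C1x_def intro: continuous_on_subset)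
    qed
    show "solves s (rescaled f \<tau> T) (\<lambda>s. x (\<tau> + s * T))"
      by (rule ivp_solution_rescaled[OF sol]) (use rescaled_segment[OF J(2,4) that(2)] in auto)
    show "solves s (rescaled f \<tau> T) y" using solves_mono[OF y(1)] that by simp
  qed (use that y(2) J in auto)
  define S where "S = (\<lambda>s. \<tau> + s * T) ` {0<..<1}"
  have S_iff: "t \<in> S \<longleftrightarrow> (t - \<tau>) / T \<in> {0<..<1}" for t
    unfolding S_def using \<open>T \<noteq> 0\<close> by (auto simp: image_iff intro!: bexI[of _ "(t - \<tau>) / T"])
  have "S = (\<lambda>t. (t - \<tau>) / T) -` {0<..<1}" using S_iff by blast
  then have "open S" using \<open>T \<noteq> 0\<close> by (auto intro!: open_vimage continuous_intros)
  define z where "z t = (if t \<in> J then x t else y ((t - \<tau>) / T))" for t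
  have zS: "z t = y ((t - \<tau>) / T)" if "t \<in> S" for t
    using agree[of "(t - \<tau>) / T"] that S_iff[of t] \<open>T \<noteq> 0\<close> by (auto simp: z_def)
  have "ivp_solution I f \<tau> \<eta> (J \<union> S) z"
    unfolding ivp_solution_def
  proof (intro conjI ballI)
    \<comment> \<open>\<open>S\<close> leaves out \<tau> so as to be open. Adding \<tau>, which lies
      in \<open>J\<close> anyway, gives a half-open segment that meets \<open>J\<close>, and the
      union is seen to be connected.\<close>
    have "J \<union> S = J \<union> (\<lambda>s. \<tau> + s * T) ` {0..<1}"
    proof -
      have "{0..<1} = insert 0 {0<..<1::real}" by auto
      then show ?thesis using J(4) by (auto simp: S_def)
    qed
    moreover have "connected ((\<lambda>s. \<tau> + s * T) ` {0..<1})"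
      by (intro connected_continuous_image continuous_intros) auto
    moreover have "\<tau> \<in> (\<lambda>s. \<tau> + s * T) ` {0..<1}" by (rule image_eqI[of _ _ 0]) auto
    ultimately have "connected (J \<union> S)"
      using J(2,4) by (auto simp: is_interval_connected_1 intro!: connected_Un)
    then show "is_interval (J \<union> S)" by (simp add: is_interval_connected_1)
    show "J \<union> S \<subseteq> I" using J(3) I by (auto simp: S_def)
    show "open (J \<union> S)" using J(1) \<open>open S\<close> by (rule open_Un)
    show "\<tau> \<in> J \<union> S" "z \<tau> = \<eta>" using J by (auto simp: z_def)
    fix t assume "t \<in> J \<union> S"
    then show "(z has_vector_derivative f t (z t)) (at t)"
    proof (cases "t \<in> J")
      case True
      then show ?thesis
        using has_vector_derivative_transform_within_open[OF x'[OF True] J(1) True, of z] by (simp add: z_def)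
    next
      case False
      with \<open>t \<in> J \<union> S\<close> have "t \<in> S" by simp
      define s where "s = (t - \<tau>) / T"
      have s: "s \<in> {0<..<1}" using \<open>t \<in> S\<close> S_iff[of t] by (simp add: s_def)
      have "(y has_vector_derivative T *\<^sub>R f t (y s)) (at s within {0..1})"
        using solvesD[OF y(1), of s] s \<open>T \<noteq> 0\<close> by (simp add: rescaled_def s_def)
      then have "(y has_vector_derivative T *\<^sub>R f t (y s)) (at s)"
        using s at_within_interior[of s "{0..1}"] by simp
      moreover have "((\<lambda>t. (t - \<tau>) / T) has_vector_derivative 1 / T) (at t)"
        using \<open>T \<noteq> 0\<close>
        by (auto intro!: derivative_eq_intros simp: has_real_derivative_iff_has_vector_derivative[symmetric])
      ultimately have "((\<lambda>t. y ((t - \<tau>) / T)) has_vector_derivative (1 / T) *\<^sub>R T *\<^sub>R f t (y s)) (at t)"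
        using vector_diff_chain_at[of "\<lambda>t. (t - \<tau>) / T" "1 / T" t y "T *\<^sub>R f t (y s)"]
        by (simp only: o_def s_def)
      then have "((\<lambda>t. y ((t - \<tau>) / T)) has_vector_derivative f t (z t)) (at t)"
        using \<open>T \<noteq> 0\<close> zS[OF \<open>t \<in> S\<close>] by (simp add: s_def)
      then show ?thesis
        by (rule has_vector_derivative_transform_within_open[OF _ \<open>open S\<close> \<open>t \<in> S\<close>]) (simp add: zS)
    qed
  qed
  moreover have "\<forall>t\<in>J. z t = x t" by (simp add: z_def)
  ultimately have "J \<union> S = J" using max unfolding maximal_ivp_solution_def by blast
  then have "S \<subseteq> J" by blast
  then show "\<tau> + s * T \<in> J"
    using s J(4) by (cases "s = 0") (auto simp: S_def image_subset_iff)
  then show "x (\<tau> + s * T) = y s" using agree s by blast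
qed

text \<open>The interface between the given \<phi> and the theory on a compact interval. Nearby
  maximal solutions are shown to reach every \<open>s < 1\<close> but not the end itself. For this
  reason the variations are attached to \<open>X\<close> on \<open>{0..1}\<close>, while \<phi> is
  compared with \<open>X\<close> on \<open>{0..<1}\<close>.\<close>

theorem maximal_flow_third_order_variations:
  fixes f :: "real \<Rightarrow> real ^ 'n::finite \<Rightarrow> real ^ 'n"
  assumes C: "C_in_x 3 I f"
    and max: "\<And>\<tau> \<xi>. \<tau> \<in> I \<Longrightarrow> maximal_ivp_solution I f \<tau> \<xi> (J \<tau> \<xi>) (\<lambda>t. \<phi> t \<tau> \<xi>)"
    and "\<tau> \<in> I" and T: "\<tau> + T \<in> J \<tau> \<xi>" "T \<noteq> 0"
  obtains U X A1 A2 A3 B1 B2 B3 where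
    "open U" "\<xi> \<in> U"
    "\<And>\<eta>. \<eta> \<in> U \<Longrightarrow> solves 1 (rescaled f \<tau> T) (X \<eta>)"
    "\<And>\<eta>. \<eta> \<in> U \<Longrightarrow> X \<eta> 0 = \<eta>"
    "\<And>\<eta> s. \<eta> \<in> U \<Longrightarrow> s \<in> {0..<1} \<Longrightarrow> \<tau> + s * T \<in> J \<tau> \<eta> \<and> \<phi> (\<tau> + s * T) \<tau> \<eta> = X \<eta> s"
    "\<And>\<xi> s. \<xi> \<in> U \<Longrightarrow> s \<in> {0..1} \<Longrightarrow> ((\<lambda>\<eta>. X \<eta> s) has_derivative A1 s \<xi>) (at \<xi>)"
    "\<And>\<xi> s u. \<xi> \<in> U \<Longrightarrow> s \<in> {0..1} \<Longrightarrow> ((\<lambda>\<eta>. A1 s \<eta> u) has_derivative A2 s \<xi> u) (at \<xi>)"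
    "\<And>\<xi> s u v. \<xi> \<in> U \<Longrightarrow> s \<in> {0..1} \<Longrightarrow> ((\<lambda>\<eta>. A2 s \<eta> u v) has_derivative A3 s \<xi> u v) (at \<xi>)"
    "\<And>\<xi> s. \<xi> \<in> U \<Longrightarrow> s \<in> {0..1} \<Longrightarrow> ((\<lambda>\<eta>. rescaled f \<tau> T s (X \<eta> s)) has_derivative B1 s \<xi>) (at \<xi>)"
    "\<And>\<xi> s u. \<xi> \<in> U \<Longrightarrow> s \<in> {0..1} \<Longrightarrow> ((\<lambda>\<eta>. B1 s \<eta> u) has_derivative B2 s \<xi> u) (at \<xi>)"
    "\<And>\<xi> s u v. \<xi> \<in> U \<Longrightarrow> s \<in> {0..1} \<Longrightarrow> ((\<lambda>\<eta>. B2 s \<eta> u v) has_derivative B3 s \<xi> u v) (at \<xi>)"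
    "\<And>\<xi> s u. \<xi> \<in> U \<Longrightarrow> s \<in> {0..1} \<Longrightarrow>
      ((\<lambda>s. A1 s \<xi> u) has_vector_derivative B1 s \<xi> u) (at s within {0..1})"
    "\<And>\<xi> s u v. \<xi> \<in> U \<Longrightarrow> s \<in> {0..1} \<Longrightarrow>
      ((\<lambda>s. A2 s \<xi> u v) has_vector_derivative B2 s \<xi> u v) (at s within {0..1})"
    "\<And>\<xi> s u v w. \<xi> \<in> U \<Longrightarrow> s \<in> {0..1} \<Longrightarrow>
      ((\<lambda>s. A3 s \<xi> u v w) has_vector_derivative B3 s \<xi> u v w) (at s within {0..1})"
    "\<And>s h. s \<in> {0..<1} \<Longrightarrow> D1 (\<phi> (\<tau> + s * T) \<tau>) \<xi> *v h = A1 s \<xi> h"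
    "\<And>s h. s \<in> {0..<1} \<Longrightarrow> D2 (\<phi> (\<tau> + s * T) \<tau>) \<xi> *v (h \<otimes> h) = A2 s \<xi> h h"
    "\<And>s h. s \<in> {0..<1} \<Longrightarrow> D3 (\<phi> (\<tau> + s * T) \<tau>) \<xi> *v (h \<otimes> h \<otimes> h) = A3 s \<xi> h h h"
proof -
  have sol: "ivp_solution I f \<tau> \<xi> (J \<tau> \<xi>) (\<lambda>t. \<phi> t \<tau> \<xi>)"
    using max[OF \<open>\<tau> \<in> I\<close>] by (simp add: maximal_ivp_solution_def)
  then have J: "is_interval (J \<tau> \<xi>)" "J \<tau> \<xi> \<subseteq> I" "\<tau> \<in> J \<tau> \<xi>" "\<phi> \<tau> \<tau> \<xi> = \<xi>"
    by (auto simp: ivp_solution_def)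
  have seg: "\<tau> + s * T \<in> J \<tau> \<xi>" if "s \<in> {0..1}" for s
    using rescaled_segment[OF J(1,3), of 1 T s] T(1) that by simp
  then have segI: "\<tau> + s * T \<in> I" if "s \<in> {0..1}" for s using J(2) that by blast
  have C3: "C_in_x (Suc (Suc (Suc 0))) I f" using C by (simp add: numeral_3_eq_3)
  let ?g = "\<lambda>s. \<tau> + s * T"
  have g: "continuous_on {0..1} ?g" "?g ` {0..1} \<subseteq> I"
    using segI by (auto intro!: continuous_intros)
  define p1 where "p1 i s x = T *\<^sub>R partial_deriv i (f (?g s)) x" for i s x
  define p2 where "p2 i j s x = T *\<^sub>R partial_deriv j (partial_deriv i (f (?g s))) x" for i j s x
  define F' where "F' s x v = (\<Sum>i\<in>UNIV. v $ i *\<^sub>R p1 i s x)" for s x v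
  have C0: "C1x {0..1} (rescaled f \<tau> T) F'"
    using C_in_x_C1x[OF C3 g, of T] by (simp add: rescaled_def[abs_def] F'_def[abs_def] p1_def)
  have C1: "C1x {0..1} (p1 i) (\<lambda>s x v. \<Sum>j\<in>UNIV. v $ j *\<^sub>R p2 i j s x)" for i
    using C_in_x_C1x[OF C_in_x_partial_deriv[OF C3] g, of T] by (simp add: p1_def[abs_def] p2_def)
  have C2: "\<exists>q. C1x {0..1} (p2 i j) q" for i j
    using C_in_x_C1x[OF C_in_x_partial_deriv[OF C_in_x_partial_deriv[OF C3]] g, of T] by (auto simp: p2_def[abs_def])
  then obtain q where C2: "\<And>i j. C1x {0..1} (p2 i j) (q i j)" by metis
  obtain F1' F2' where var_ext: "C1x {0..1} (var_ext (rescaled f \<tau> T) F') F1'"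
    "C1x {0..1} (var_ext (var_ext (rescaled f \<tau> T) F') F1') F2'"
    by (rule C1x_var_ext_partials[OF C0[unfolded F'_def[abs_def]] C1 C2]) (simp add: F'_def[abs_def, symmetric])
  have "solves 1 (rescaled f \<tau> T) (\<lambda>s. \<phi> (\<tau> + s * T) \<tau> \<xi>)"
    by (rule ivp_solution_rescaled[OF sol seg])
  \<comment> \<open>This gives openness of the domain of the flow: solutions from initial values
    near \<xi> exist on the same rescaled interval.\<close>
  from solution_tube[OF C0 this] J(4) obtain \<delta> where "0 < \<delta>"
    and \<delta>: "\<And>\<eta>. dist \<eta> \<xi> < \<delta> \<Longrightarrow> \<exists>x. solves 1 (rescaled f \<tau> T) x \<and> x 0 = \<eta>"
    by (auto) metis
  define U where "U = ball \<xi> \<delta>"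
  have U: "open U" "\<xi> \<in> U" using \<open>0 < \<delta>\<close> by (auto simp: U_def)
  have "\<forall>\<eta>\<in>U. \<exists>x. solves 1 (rescaled f \<tau> T) x \<and> x 0 = \<eta>"
    using \<delta> by (simp add: U_def dist_commute)
  then obtain X where X: "\<And>\<eta>. \<eta> \<in> U \<Longrightarrow> solves 1 (rescaled f \<tau> T) (X \<eta>)" "\<And>\<eta>. \<eta> \<in> U \<Longrightarrow> X \<eta> 0 = \<eta>"
    by metis
  have \<phi>: "\<tau> + s * T \<in> J \<tau> \<eta> \<and> \<phi> (\<tau> + s * T) \<tau> \<eta> = X \<eta> s" if "\<eta> \<in> U" "s \<in> {0..<1}" for \<eta> s
    using maximal_solution_contains[OF max[OF \<open>\<tau> \<in> I\<close>] C0 segI X(1)[OF that(1)] X(2)[OF that(1)] T(2) that(2)] by blast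
  from flow_third_order_variations[OF C0 var_ext zero_le_one U(1) X]
  obtain A1 A2 A3 B1 B2 B3 where V:
    "\<And>\<xi> t. \<xi> \<in> U \<Longrightarrow> t \<in> {0..1} \<Longrightarrow> ((\<lambda>\<eta>. X \<eta> t) has_derivative A1 t \<xi>) (at \<xi>)"
    "\<And>\<xi> t u. \<xi> \<in> U \<Longrightarrow> t \<in> {0..1} \<Longrightarrow> ((\<lambda>\<eta>. A1 t \<eta> u) has_derivative A2 t \<xi> u) (at \<xi>)"
    "\<And>\<xi> t u v. \<xi> \<in> U \<Longrightarrow> t \<in> {0..1} \<Longrightarrow> ((\<lambda>\<eta>. A2 t \<eta> u v) has_derivative A3 t \<xi> u v) (at \<xi>)"
    "\<And>\<xi> t. \<xi> \<in> U \<Longrightarrow> t \<in> {0..1} \<Longrightarrow> ((\<lambda>\<eta>. rescaled f \<tau> T t (X \<eta> t)) has_derivative B1 t \<xi>) (at \<xi>)"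
    "\<And>\<xi> t u. \<xi> \<in> U \<Longrightarrow> t \<in> {0..1} \<Longrightarrow> ((\<lambda>\<eta>. B1 t \<eta> u) has_derivative B2 t \<xi> u) (at \<xi>)"
    "\<And>\<xi> t u v. \<xi> \<in> U \<Longrightarrow> t \<in> {0..1} \<Longrightarrow> ((\<lambda>\<eta>. B2 t \<eta> u v) has_derivative B3 t \<xi> u v) (at \<xi>)"
    "\<And>\<xi> t u. \<xi> \<in> U \<Longrightarrow> t \<in> {0..1} \<Longrightarrow>
      ((\<lambda>t. A1 t \<xi> u) has_vector_derivative B1 t \<xi> u) (at t within {0..1})"
    "\<And>\<xi> t u v. \<xi> \<in> U \<Longrightarrow> t \<in> {0..1} \<Longrightarrow>
      ((\<lambda>t. A2 t \<xi> u v) has_vector_derivative B2 t \<xi> u v) (at t within {0..1})"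
    "\<And>\<xi> t u v w. \<xi> \<in> U \<Longrightarrow> t \<in> {0..1} \<Longrightarrow>
      ((\<lambda>t. A3 t \<xi> u v w) has_vector_derivative B3 t \<xi> u v w) (at t within {0..1})"
    by blast
  have g1: "(\<phi> (\<tau> + s * T) \<tau> has_derivative A1 s \<eta>) (at \<eta>)" if "s \<in> {0..<1}" "\<eta> \<in> U" for s \<eta>
    by (rule has_derivative_transform_within_open[OF V(1) U(1) that(2)]) (use that \<phi> in auto)
  note D = iterated_differentials[OF U(1) g1 V(2,3) U(2)]
  show ?thesis
    by (rule that[OF U X \<phi> V]) (assumption | rule D | simp)+
qed

section \<open>Algebra of the identity\<close>

text \<open>Applied to the time slice \<open>s = 0\<close>, where the flow is the identity map. Its
  derivative does not depend on the point, so the higher ones vanish.\<close>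

lemma flow_variations_initial:
  assumes "open U" and X: "\<And>\<eta>. \<eta> \<in> U \<Longrightarrow> X \<eta> = \<eta>"
    and A: "\<And>\<xi>. \<xi> \<in> U \<Longrightarrow> (X has_derivative A1 \<xi>) (at \<xi>)"
      "\<And>\<xi> u. \<xi> \<in> U \<Longrightarrow> ((\<lambda>\<eta>. A1 \<eta> u) has_derivative A2 \<xi> u) (at \<xi>)"
      "\<And>\<xi> u v. \<xi> \<in> U \<Longrightarrow> ((\<lambda>\<eta>. A2 \<eta> u v) has_derivative A3 \<xi> u v) (at \<xi>)"
    and "\<xi> \<in> U"
  shows "A1 \<xi> u = u" "A2 \<xi> u v = 0" "A3 \<xi> u v w = 0"
proof -
  have 1: "A1 \<eta> u = u" if "\<eta> \<in> U" for \<eta> u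
    using has_derivative_unique[OF A(1)[OF that]
        has_derivative_transform_within_open[OF has_derivative_ident \<open>open U\<close> that]] X by metis
  have 2: "A2 \<eta> u v = 0" if "\<eta> \<in> U" for \<eta> u v
    using has_derivative_unique[OF A(2)[OF that]
        has_derivative_transform_within_open[OF has_derivative_const \<open>open U\<close> that]] 1 by metis
  have 3: "A3 \<eta> u v w = 0" if "\<eta> \<in> U" for \<eta> u v w
    using has_derivative_unique[OF A(3)[OF that]
        has_derivative_transform_within_open[OF has_derivative_const \<open>open U\<close> that]] 2 by metis
  show "A1 \<xi> u = u" "A2 \<xi> u v = 0" "A3 \<xi> u v w = 0" using 1 2 3 \<open>\<xi> \<in> U\<close> by auto
qed

text \<open>\<open>L\<close> is the derivative of the Riccati map at \<open>X \<xi>\<close>. The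
  second derivative of that map is
  \<open>(c \<bullet> u) *\<^sub>R v + (c \<bullet> v) *\<^sub>R u\<close> and the third is 0. The
  factors 2 and 3 come from setting all directions equal: the second-order term is the second
  derivative at \<open>(A1, A1)\<close>, the third-order one is three times the second derivative at
  \<open>(A1, A2)\<close>.\<close>

lemma riccati_third_order_variations:
  fixes X :: "'b::real_normed_vector \<Rightarrow> 'a::real_inner"
  assumes "open U" and M: "bounded_linear M"
    and A: "\<And>\<xi>. \<xi> \<in> U \<Longrightarrow> (X has_derivative A1 \<xi>) (at \<xi>)"
      "\<And>\<xi> u. \<xi> \<in> U \<Longrightarrow> ((\<lambda>\<eta>. A1 \<eta> u) has_derivative A2 \<xi> u) (at \<xi>)"
      "\<And>\<xi> u v. \<xi> \<in> U \<Longrightarrow> ((\<lambda>\<eta>. A2 \<eta> u v) has_derivative A3 \<xi> u v) (at \<xi>)"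
    and B: "\<And>\<xi>. \<xi> \<in> U \<Longrightarrow> ((\<lambda>\<eta>. a + M (X \<eta>) + (c \<bullet> X \<eta>) *\<^sub>R X \<eta>) has_derivative B1 \<xi>) (at \<xi>)"
      "\<And>\<xi> u. \<xi> \<in> U \<Longrightarrow> ((\<lambda>\<eta>. B1 \<eta> u) has_derivative B2 \<xi> u) (at \<xi>)"
      "\<And>\<xi> u v. \<xi> \<in> U \<Longrightarrow> ((\<lambda>\<eta>. B2 \<eta> u v) has_derivative B3 \<xi> u v) (at \<xi>)"
    and "\<xi> \<in> U"
  defines "L \<equiv> \<lambda>y. M y + (c \<bullet> y) *\<^sub>R X \<xi> + (c \<bullet> X \<xi>) *\<^sub>R y"
  shows "B1 \<xi> u = L (A1 \<xi> u)"
    and "B2 \<xi> u u = L (A2 \<xi> u u) + (2 * (c \<bullet> A1 \<xi> u)) *\<^sub>R A1 \<xi> u"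
    and "B3 \<xi> u u u = L (A3 \<xi> u u u) + (3 * (c \<bullet> A2 \<xi> u u)) *\<^sub>R A1 \<xi> u + (3 * (c \<bullet> A1 \<xi> u)) *\<^sub>R A2 \<xi> u u"
proof -
  note intros = has_derivative_add has_derivative_scaleR has_derivative_inner_right
    bounded_linear.has_derivative[OF M] A
  have 1: "B1 \<eta> u = M (A1 \<eta> u) + ((c \<bullet> X \<eta>) *\<^sub>R A1 \<eta> u + (c \<bullet> A1 \<eta> u) *\<^sub>R X \<eta>)" if "\<eta> \<in> U" for \<eta> u
  proof -
    have "((\<lambda>\<eta>. a + M (X \<eta>) + (c \<bullet> X \<eta>) *\<^sub>R X \<eta>) has_derivative
        (\<lambda>u. 0 + M (A1 \<eta> u) + ((c \<bullet> X \<eta>) *\<^sub>R A1 \<eta> u + (c \<bullet> A1 \<eta> u) *\<^sub>R X \<eta>))) (at \<eta>)"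
      by (intro intros has_derivative_const that)
    from has_derivative_unique[OF B(1)[OF that] this] show ?thesis by simp
  qed
  have 2: "B2 \<eta> u v = M (A2 \<eta> u v) + (((c \<bullet> X \<eta>) *\<^sub>R A2 \<eta> u v + (c \<bullet> A1 \<eta> v) *\<^sub>R A1 \<eta> u)
      + ((c \<bullet> A1 \<eta> u) *\<^sub>R A1 \<eta> v + (c \<bullet> A2 \<eta> u v) *\<^sub>R X \<eta>))" if "\<eta> \<in> U" for \<eta> u v
  proof -
    have "((\<lambda>\<eta>. M (A1 \<eta> u) + ((c \<bullet> X \<eta>) *\<^sub>R A1 \<eta> u + (c \<bullet> A1 \<eta> u) *\<^sub>R X \<eta>)) has_derivative
        (\<lambda>v. M (A2 \<eta> u v) + (((c \<bullet> X \<eta>) *\<^sub>R A2 \<eta> u v + (c \<bullet> A1 \<eta> v) *\<^sub>R A1 \<eta> u)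
          + ((c \<bullet> A1 \<eta> u) *\<^sub>R A1 \<eta> v + (c \<bullet> A2 \<eta> u v) *\<^sub>R X \<eta>)))) (at \<eta>)"
      by (intro intros that)
    from has_derivative_transform_within_open[OF this \<open>open U\<close> that 1[symmetric]]
    have "((\<lambda>\<eta>. B1 \<eta> u) has_derivative (\<lambda>v. M (A2 \<eta> u v) + (((c \<bullet> X \<eta>) *\<^sub>R A2 \<eta> u v + (c \<bullet> A1 \<eta> v) *\<^sub>R A1 \<eta> u)
          + ((c \<bullet> A1 \<eta> u) *\<^sub>R A1 \<eta> v + (c \<bullet> A2 \<eta> u v) *\<^sub>R X \<eta>)))) (at \<eta>)" .
    from has_derivative_unique[OF B(2)[OF that] this] show ?thesis by simp
  qed
  have 3: "B3 \<xi> u v w = M (A3 \<xi> u v w)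
      + ((((c \<bullet> X \<xi>) *\<^sub>R A3 \<xi> u v w + (c \<bullet> A1 \<xi> w) *\<^sub>R A2 \<xi> u v) + ((c \<bullet> A1 \<xi> v) *\<^sub>R A2 \<xi> u w + (c \<bullet> A2 \<xi> v w) *\<^sub>R A1 \<xi> u))
      + (((c \<bullet> A1 \<xi> u) *\<^sub>R A2 \<xi> v w + (c \<bullet> A2 \<xi> u w) *\<^sub>R A1 \<xi> v)
        + ((c \<bullet> A2 \<xi> u v) *\<^sub>R A1 \<xi> w + (c \<bullet> A3 \<xi> u v w) *\<^sub>R X \<xi>)))" (is "_ = ?R w") for u v w
  proof -
    have "((\<lambda>\<eta>. M (A2 \<eta> u v) + (((c \<bullet> X \<eta>) *\<^sub>R A2 \<eta> u v + (c \<bullet> A1 \<eta> v) *\<^sub>R A1 \<eta> u)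
      + ((c \<bullet> A1 \<eta> u) *\<^sub>R A1 \<eta> v + (c \<bullet> A2 \<eta> u v) *\<^sub>R X \<eta>))) has_derivative ?R) (at \<xi>)"
      by (intro intros \<open>\<xi> \<in> U\<close>)
    from has_derivative_transform_within_open[OF this \<open>open U\<close> \<open>\<xi> \<in> U\<close> 2[symmetric]]
    have "((\<lambda>\<eta>. B2 \<eta> u v) has_derivative ?R) (at \<xi>)" .
    from has_derivative_unique[OF B(3)[OF \<open>\<xi> \<in> U\<close>] this] show ?thesis by simp
  qed
  show "B1 \<xi> u = L (A1 \<xi> u)" by (simp add: 1 \<open>\<xi> \<in> U\<close> L_def)
  show "B2 \<xi> u u = L (A2 \<xi> u u) + (2 * (c \<bullet> A1 \<xi> u)) *\<^sub>R A1 \<xi> u"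
    unfolding 2[OF \<open>\<xi> \<in> U\<close>] L_def mult_2 scaleR_add_left by (simp only: ac_simps)
  have three: "(3 * r) *\<^sub>R y = r *\<^sub>R y + r *\<^sub>R y + r *\<^sub>R y" for r :: real and y :: 'a
  proof -
    have "3 * r = r + r + r" by simp
    then show ?thesis by (simp only: scaleR_add_left)
  qed
  show "B3 \<xi> u u u = L (A3 \<xi> u u u) + (3 * (c \<bullet> A2 \<xi> u u)) *\<^sub>R A1 \<xi> u + (3 * (c \<bullet> A1 \<xi> u)) *\<^sub>R A2 \<xi> u u"
    unfolding 3 L_def three by (simp only: ac_simps)
qed

text \<open>\<open>k\<close> is the integral of \<open>2 * m\<close>, so that the derivative of
  \<open>k s *\<^sub>R u1 s\<close> reproduces the forcing term of \<open>u2\<close>. After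
  subtraction only the homogeneous linear equation with initial value 0 remains, and Gronwall makes
  the difference vanish.\<close>

lemma riccati_variations_proportional:
  fixes u1 u2 u3 :: "real \<Rightarrow> 'a::real_inner"
  assumes L: "\<And>s. s \<in> {0..1} \<Longrightarrow> linear (L s)" "\<And>s y. s \<in> {0..1} \<Longrightarrow> norm (L s y) \<le> K * norm y" "0 \<le> K"
    and m: "continuous_on {0..1} m"
    and u1: "\<And>s. s \<in> {0..1} \<Longrightarrow> (u1 has_vector_derivative L s (u1 s)) (at s within {0..1})"
    and u2: "\<And>s. s \<in> {0..1} \<Longrightarrow> (u2 has_vector_derivative L s (u2 s) + (2 * m s) *\<^sub>R u1 s) (at s within {0..1})"
    and u3: "\<And>s. s \<in> {0..1} \<Longrightarrow> (u3 has_vector_derivative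
        L s (u3 s) + (3 * (c s \<bullet> u2 s)) *\<^sub>R u1 s + (3 * m s) *\<^sub>R u2 s) (at s within {0..1})"
    and m_def: "\<And>s. s \<in> {0..1} \<Longrightarrow> m s = c s \<bullet> u1 s"
    and "u2 0 = 0" "u3 0 = 0" and s: "s \<in> {0..1}"
  obtains k where "u2 s = k *\<^sub>R u1 s" "u3 s = (3 / 2 * k\<^sup>2) *\<^sub>R u1 s"
proof -
  have zero: "r s = 0" if "\<And>s. s \<in> {0..1} \<Longrightarrow> (r has_vector_derivative L s (r s)) (at s within {0..1})"
    "r 0 = 0" "s \<in> {0..1}" for r s
    using gronwall[where r = r and r' = "\<lambda>s. L s (r s)" and e = 0, OF that(1) _ L(3) _ that(3)] L(2) that(2) by auto
  define k where "k s = integral {0..s} (\<lambda>s. 2 * m s)" for s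
  have k: "(k has_vector_derivative 2 * m s) (at s within {0..1})" if "s \<in> {0..1}" for s
    unfolding k_def by (rule integral_has_vector_derivative[OF _ that]) (intro continuous_intros m)
  have k_scale: "((\<lambda>s. p s *\<^sub>R u1 s) has_vector_derivative p s *\<^sub>R L s (u1 s) + p' *\<^sub>R u1 s) (at s within {0..1})"
    if "(p has_vector_derivative p') (at s within {0..1})" "s \<in> {0..1}" for p p' s
    using has_vector_derivative_scaleR[of p p' s "{0..1}" u1, OF _ u1[OF that(2)]] that(1)
    by (simp add: has_real_derivative_iff_has_vector_derivative)
  have 2: "u2 s = k s *\<^sub>R u1 s" if s: "s \<in> {0..1}" for s
  proof -
    have "u2 s - k s *\<^sub>R u1 s = 0"
    proof (rule zero[OF _ _ s])
      fix s :: real assume s: "s \<in> {0..1}"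
      have "((\<lambda>s. u2 s - k s *\<^sub>R u1 s) has_vector_derivative
          (L s (u2 s) + (2 * m s) *\<^sub>R u1 s) - (k s *\<^sub>R L s (u1 s) + (2 * m s) *\<^sub>R u1 s)) (at s within {0..1})"
        by (intro has_vector_derivative_diff u2 k_scale k s)
      then show "((\<lambda>s. u2 s - k s *\<^sub>R u1 s) has_vector_derivative L s (u2 s - k s *\<^sub>R u1 s)) (at s within {0..1})"
        by (simp add: linear_diff[OF L(1)[OF s]] linear_scale[OF L(1)[OF s]])
    qed (simp add: \<open>u2 0 = 0\<close> k_def)
    then show ?thesis by simp
  qed
  \<comment> \<open>With \<open>u2 = k *\<^sub>R u1\<close> the forcing of \<open>u3\<close> is
    \<open>6 * k * m\<close> times \<open>u1\<close>. Since \<open>k\<close> has derivative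
    \<open>2 * m\<close>, its antiderivative is \<open>3 / 2\<close> times the square of
    \<open>k\<close>.\<close>
  have k2: "((\<lambda>s. 3 / 2 * (k s)\<^sup>2) has_vector_derivative 6 * k s * m s) (at s within {0..1})" if "s \<in> {0..1}" for s
    using k[OF that] unfolding has_real_derivative_iff_has_vector_derivative[symmetric]
    by (auto intro!: derivative_eq_intros)
  have "u3 s - (3 / 2 * (k s)\<^sup>2) *\<^sub>R u1 s = 0"
  proof (rule zero[OF _ _ s])
    fix s :: real assume s: "s \<in> {0..1}"
    have "((\<lambda>s. u3 s - (3 / 2 * (k s)\<^sup>2) *\<^sub>R u1 s) has_vector_derivative
        (L s (u3 s) + (3 * (c s \<bullet> u2 s)) *\<^sub>R u1 s + (3 * m s) *\<^sub>R u2 s)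
        - ((3 / 2 * (k s)\<^sup>2) *\<^sub>R L s (u1 s) + (6 * k s * m s) *\<^sub>R u1 s)) (at s within {0..1})"
      by (intro has_vector_derivative_diff u3 k_scale k2 s)
    moreover have "(3 * (c s \<bullet> u2 s)) *\<^sub>R u1 s + (3 * m s) *\<^sub>R u2 s = (6 * k s * m s) *\<^sub>R u1 s"
      by (simp add: 2[OF s] m_def[OF s] flip: scaleR_add_left)
    ultimately show "((\<lambda>s. u3 s - (3 / 2 * (k s)\<^sup>2) *\<^sub>R u1 s) has_vector_derivative
        L s (u3 s - (3 / 2 * (k s)\<^sup>2) *\<^sub>R u1 s)) (at s within {0..1})"
      by (simp add: linear_diff[OF L(1)[OF s]] linear_scale[OF L(1)[OF s]] add.assoc)
  qed (simp add: \<open>u3 0 = 0\<close> k_def)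
  then show ?thesis using that[of "k s"] 2[OF s] by simp
qed

section \<open>Consequences of the Kronecker identity at a fixed time\<close>

lemma kronecker_identity_of_proportional:
  assumes "v = k *\<^sub>R u" "w = (3 / 2 * k\<^sup>2) *\<^sub>R u"
  shows "w \<otimes> u + u \<otimes> w - 3 *\<^sub>R (v \<otimes> v) = 0"
  by (simp add: assms vec_eq_iff kronecker_def power2_eq_square algebra_simps)

lemma kronecker_identity_nth:
  assumes "w \<otimes> u + u \<otimes> w - 3 *\<^sub>R (v \<otimes> v) = 0"
  shows "w $ i * u $ j + u $ i * w $ j = 3 * (v $ i * v $ j)"
  using arg_cong[OF assms, of "\<lambda>z. z $ (i, j)"] by (simp add: kronecker_def)

text \<open>The squared 2x2 minor, times 3, is a combination of the terms
  \<open>3 * (v $ i * v $ i)\<close>, \<open>3 * (v $ i * v $ j)\<close> and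
  \<open>3 * (v $ j * v $ j)\<close>. Replacing each by its value from the identity cancels
  everything, and a real square equal to 0 has root 0.\<close>

lemma kronecker_identity_parallel:
  assumes "w \<otimes> u + u \<otimes> w - 3 *\<^sub>R (v \<otimes> v) = 0"
  shows "v $ i * u $ j = v $ j * u $ i"
proof -
  note id = kronecker_identity_nth[OF assms]
  have "3 * (v $ i * u $ j - v $ j * u $ i)\<^sup>2 = 3 * (v $ i * v $ i) * (u $ j)\<^sup>2
      - 2 * (3 * (v $ i * v $ j)) * (u $ i * u $ j) + 3 * (v $ j * v $ j) * (u $ i)\<^sup>2"
    by (simp add: power2_eq_square algebra_simps)
  also have "\<dots> = 0"
    unfolding id[symmetric] by (simp add: power2_eq_square algebra_simps)
  finally show ?thesis by simp
qed

text \<open>For comparing derivatives at the initial time, the left end of the rescaled interval.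
  The expressions concerned are known to vanish only for \<open>s < 1\<close>, so a closed
  subinterval \<open>{0..1/2}\<close> is used.\<close>

lemma right_derivative_zero:
  fixes E :: "real \<Rightarrow> 'a::real_normed_vector"
  assumes E: "(E has_vector_derivative d) (at 0 within {0..1})" and "\<And>s. s \<in> {0..<1} \<Longrightarrow> E s = 0"
  shows "d = 0"
proof -
  have "(E has_vector_derivative d) (at 0 within cbox 0 (1/2))"
    using has_vector_derivative_within_subset[OF E, of "{0..1/2}"] by simp
  moreover have "(E has_vector_derivative 0) (at 0 within cbox 0 (1/2))"
    by (rule has_vector_derivative_transform[where f = "\<lambda>_. 0"]) (use assms(2) in auto)
  ultimately show ?thesis
    by (rule vector_derivative_unique_within_closed_interval[rotated 2]) auto
qed

text \<open>\<open>Q\<close> determines only the symmetrised coefficients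
  \<open>C a b + C b a\<close>. Testing on a basis vector shows that \<open>C a a\<close> is a
  multiple of it; testing on the sum and the difference of two basis vectors gives two linear
  equations for the two remaining components of the mixed coefficient.\<close>

lemma quadratic_parallel:
  fixes C :: "'n::finite \<Rightarrow> 'n \<Rightarrow> real ^ 'n"
  defines "Q \<equiv> \<lambda>x. \<Sum>i\<in>UNIV. x $ i *\<^sub>R (\<Sum>j\<in>UNIV. x $ j *\<^sub>R C i j)"
  assumes par: "\<And>x k l. Q x $ k * x $ l = Q x $ l * x $ k"
  shows "Q x = ((\<chi> i. C i i $ i) \<bullet> x) *\<^sub>R x"
proof -
  have sum2: "(\<Sum>i\<in>UNIV. (axis a 1 + r *\<^sub>R axis b 1 :: real ^ 'n) $ i *\<^sub>R g i) = g a + r *\<^sub>R g b"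
    for a b r and g :: "'n \<Rightarrow> real ^ 'n"
    by (simp add: axis_def scaleR_add_left sum.distrib if_distrib[of "\<lambda>x. x *\<^sub>R _"] if_distrib[of "\<lambda>x. _ * x"] cong: if_cong)
  have Q2: "Q (axis a 1 + r *\<^sub>R axis b 1) = C a a + r *\<^sub>R (C a b + C b a) + (r * r) *\<^sub>R C b b" for a b r
    unfolding Q_def sum2 by (simp add: algebra_simps)
  have diag: "C a a $ k = (if k = a then C a a $ a else 0)" for a k
    using par[of "axis a 1 + 0 *\<^sub>R axis a 1" k a] unfolding Q2 by (auto simp: axis_def)
  have off: "(C a b + C b a) $ k = (if k = a then C b b $ b else 0) + (if k = b then C a a $ a else 0)" for a b k
  proof (cases "a = b")
    case True
    then show ?thesis using diag[of a k] by simp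
  next
    case False
    have p: "(C a a + (C a b + C b a) + C b b) $ k * (axis a 1 + axis b 1 :: real ^ 'n) $ l
        = (C a a + (C a b + C b a) + C b b) $ l * (axis a 1 + axis b 1 :: real ^ 'n) $ k" for k l
      using par[of "axis a 1 + 1 *\<^sub>R axis b 1" k l] unfolding Q2 by simp
    have m: "(C a a - (C a b + C b a) + C b b) $ k * (axis a 1 - axis b 1 :: real ^ 'n) $ l
        = (C a a - (C a b + C b a) + C b b) $ l * (axis a 1 - axis b 1 :: real ^ 'n) $ k" for k l
      using par[of "axis a 1 + (-1) *\<^sub>R axis b 1" k l] unfolding Q2 by (simp add: algebra_simps)
    have "(C a b + C b a) $ k = 0" if "k \<noteq> a" "k \<noteq> b"
      using p[of k a] that False diag[of a k] diag[of b k] by (simp add: axis_def)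
    moreover have "(C a b + C b a) $ a = C b b $ b \<and> (C a b + C b a) $ b = C a a $ a"
      using p[of a b] m[of a b] False diag[of a b] diag[of b a] by (simp add: axis_def)
    ultimately show ?thesis using False by auto
  qed
  \<comment> \<open>Doubling and exchanging the summation indices in one copy brings in the
    symmetrised coefficients described by \<open>off\<close>.\<close>
  have "2 *\<^sub>R Q x = (\<Sum>i\<in>UNIV. \<Sum>j\<in>UNIV. (x $ i * x $ j) *\<^sub>R C i j) + (\<Sum>j\<in>UNIV. \<Sum>i\<in>UNIV. (x $ i * x $ j) *\<^sub>R C i j)"
  proof -
    have 1: "Q x = (\<Sum>i\<in>UNIV. \<Sum>j\<in>UNIV. (x $ i * x $ j) *\<^sub>R C i j)"
      by (simp add: Q_def scaleR_sum_right)
    have 2: "Q x = (\<Sum>j\<in>UNIV. \<Sum>i\<in>UNIV. (x $ i * x $ j) *\<^sub>R C i j)"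
      unfolding 1 by (rule sum.swap)
    show ?thesis unfolding scaleR_2 by (rule arg_cong2[where f = "(+)", OF 1 2])
  qed
  also have "\<dots> = (\<Sum>i\<in>UNIV. \<Sum>j\<in>UNIV. (x $ i * x $ j) *\<^sub>R (C i j + C j i))"
    by (simp add: sum.distrib scaleR_add_right mult.commute)
  also have "\<dots> = 2 *\<^sub>R ((\<chi> i. C i i $ i) \<bullet> x) *\<^sub>R x"
  proof (rule vec_eq_iff[THEN iffD2], rule allI)
    fix k
    have "(\<Sum>i\<in>UNIV. \<Sum>j\<in>UNIV. (x $ i * x $ j) *\<^sub>R (C i j + C j i)) $ k
      = (\<Sum>i\<in>UNIV. \<Sum>j\<in>UNIV. x $ i * x $ j * ((if k = i then C j j $ j else 0) + (if k = j then C i i $ i else 0)))"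
      by (simp add: off del: vector_add_component)
    also have "\<dots> = (\<Sum>j\<in>UNIV. x $ k * x $ j * C j j $ j) + (\<Sum>i\<in>UNIV. x $ i * x $ k * C i i $ i)"
    proof -
      have "(\<Sum>i\<in>UNIV. \<Sum>j\<in>UNIV. x $ i * x $ j * (if k = i then C j j $ j else 0)) = (\<Sum>j\<in>UNIV. x $ k * x $ j * C j j $ j)"
        by (subst sum.swap) (simp add: if_distrib[of "\<lambda>z. _ * z"] cong: if_cong)
      moreover have "(\<Sum>i\<in>UNIV. \<Sum>j\<in>UNIV. x $ i * x $ j * (if k = j then C i i $ i else 0)) = (\<Sum>i\<in>UNIV. x $ i * x $ k * C i i $ i)"
        by (simp add: if_distrib[of "\<lambda>z. _ * z"] cong: if_cong)
      ultimately show ?thesis by (simp only: distrib_left sum.distrib)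
    qed
    also have "\<dots> = (2 *\<^sub>R ((\<chi> i. C i i $ i) \<bullet> x) *\<^sub>R x) $ k"
      by (simp add: inner_vec_def sum_distrib_left sum_distrib_right sum.distrib[symmetric] mult.assoc mult.commute mult.left_commute)
    finally show "(\<Sum>i\<in>UNIV. \<Sum>j\<in>UNIV. (x $ i * x $ j) *\<^sub>R (C i j + C j i)) $ k = (2 *\<^sub>R ((\<chi> i. C i i $ i) \<bullet> x) *\<^sub>R x) $ k" .
  qed
  finally show ?thesis by (simp only: scaleR_cancel_left) simp
qed

section \<open>The characterization\<close>

text \<open>\<open>\<tau> + T\<close> is chosen slightly beyond \<open>t\<close>, as seen from
  \<tau>, still inside \<open>J\<close>. This places \<open>t\<close> at a parameter strictly below
  1 and makes \<open>T\<close> nonzero even for \<open>t = \<tau>\<close>.\<close>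

lemma rescaling_exists:
  fixes t \<tau> :: real
  assumes "open J" "t \<in> J"
  obtains T s where "T \<noteq> 0" "\<tau> + T \<in> J" "s \<in> {0..<1}" "t = \<tau> + s * T"
proof -
  obtain e where e: "0 < e" "ball t e \<subseteq> J" using assms open_contains_ball by blast
  define T where "T = t - \<tau> + (if \<tau> \<le> t then e / 2 else - e / 2)"
  have "\<tau> + T \<in> ball t e" using e(1) by (auto simp: T_def dist_real_def)
  moreover have "T \<noteq> 0" "(t - \<tau>) / T \<in> {0..<1}" using e(1) by (auto simp: T_def field_simps)
  ultimately show ?thesis using that[of T "(t - \<tau>) / T"] e(2) by auto
qed

lemma vector_riccati_imp_identity:
  fixes f :: "real \<Rightarrow> real ^ 'n::finite \<Rightarrow> real ^ 'n"
  assumes C: "C_in_x 3 I f"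
    and max: "\<And>\<tau> \<xi>. \<tau> \<in> I \<Longrightarrow> maximal_ivp_solution I f \<tau> \<xi> (J \<tau> \<xi>) (\<lambda>t. \<phi> t \<tau> \<xi>)"
    and ric: "vector_riccati I f" and "\<tau> \<in> I" and t: "t \<in> J \<tau> \<xi>"
  shows "(D3 (\<phi> t \<tau>) \<xi> *v (h \<otimes> h \<otimes> h)) \<otimes> (D1 (\<phi> t \<tau>) \<xi> *v h) + (D1 (\<phi> t \<tau>) \<xi> *v h) \<otimes> (D3 (\<phi> t \<tau>) \<xi> *v (h \<otimes> h \<otimes> h))
    - 3 *\<^sub>R ((D2 (\<phi> t \<tau>) \<xi> *v (h \<otimes> h)) \<otimes> (D2 (\<phi> t \<tau>) \<xi> *v (h \<otimes> h))) = 0"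
proof -
  obtain a B c where cont: "continuous_on I a" "continuous_on I B" "continuous_on I c"
    and f: "\<And>t x. t \<in> I \<Longrightarrow> f t x = a t + B t *v x + (c t \<bullet> x) *\<^sub>R x"
    using ric unfolding vector_riccati_def by blast
  have J: "open (J \<tau> \<xi>)" "is_interval (J \<tau> \<xi>)" "J \<tau> \<xi> \<subseteq> I" "\<tau> \<in> J \<tau> \<xi>"
    using max[OF \<open>\<tau> \<in> I\<close>, of \<xi>] by (auto simp: maximal_ivp_solution_def ivp_solution_def)
  obtain T \<sigma> where T: "T \<noteq> 0" "\<tau> + T \<in> J \<tau> \<xi>" and \<sigma>: "\<sigma> \<in> {0..<1}" "t = \<tau> + \<sigma> * T"
    using rescaling_exists[OF J(1) t, of \<tau>] by metis
  have seg: "\<tau> + s * T \<in> I" if "s \<in> {0..1}" for s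
    using rescaled_segment[OF J(2,4), of 1 T s] T(2) that J(3) by auto
  define c' where "c' s = T *\<^sub>R c (\<tau> + s * T)" for s
  define M where "M s y = T *\<^sub>R (B (\<tau> + s * T) *v y)" for s y
  have M: "bounded_linear (M s)" for s
    unfolding M_def
    by (rule bounded_linear_compose[OF bounded_linear_scaleR_right matrix_vector_mul_bounded_linear])
  have F: "rescaled f \<tau> T s x = T *\<^sub>R a (\<tau> + s * T) + M s x + (c' s \<bullet> x) *\<^sub>R x" if "s \<in> {0..1}" for s x
    by (simp add: rescaled_def f[OF seg[OF that]] c'_def M_def scaleR_add_right)
  have c'_cont: "continuous_on {0..1} c'"
    unfolding c'_def using seg
    by (intro continuous_intros continuous_on_compose2[OF cont(3)]) auto
  obtain F' where C1: "C1x {0..1} (rescaled f \<tau> T) F'"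
    using C_in_x_C1x[of 2 I f "{0..1}" "\<lambda>s. \<tau> + s * T" T] C seg
    by (force simp: rescaled_def[abs_def] numeral_3_eq_3 numeral_2_eq_2 intro!: continuous_intros)
  show ?thesis
  proof (rule maximal_flow_third_order_variations[OF C max \<open>\<tau> \<in> I\<close> T(2,1)])
    fix U X A1 A2 A3 B1 B2 B3
    assume U: "open U" "\<xi> \<in> U"
      and X: "\<And>\<eta>. \<eta> \<in> U \<Longrightarrow> solves 1 (rescaled f \<tau> T) (X \<eta>)" "\<And>\<eta>. \<eta> \<in> U \<Longrightarrow> X \<eta> 0 = \<eta>"
      and A: "\<And>\<xi> s. \<xi> \<in> U \<Longrightarrow> s \<in> {0..1} \<Longrightarrow> ((\<lambda>\<eta>. X \<eta> s) has_derivative A1 s \<xi>) (at \<xi>)"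
        "\<And>\<xi> s u. \<xi> \<in> U \<Longrightarrow> s \<in> {0..1} \<Longrightarrow> ((\<lambda>\<eta>. A1 s \<eta> u) has_derivative A2 s \<xi> u) (at \<xi>)"
        "\<And>\<xi> s u v. \<xi> \<in> U \<Longrightarrow> s \<in> {0..1} \<Longrightarrow> ((\<lambda>\<eta>. A2 s \<eta> u v) has_derivative A3 s \<xi> u v) (at \<xi>)"
      and B: "\<And>\<xi> s. \<xi> \<in> U \<Longrightarrow> s \<in> {0..1} \<Longrightarrow> ((\<lambda>\<eta>. rescaled f \<tau> T s (X \<eta> s)) has_derivative B1 s \<xi>) (at \<xi>)"
        "\<And>\<xi> s u. \<xi> \<in> U \<Longrightarrow> s \<in> {0..1} \<Longrightarrow> ((\<lambda>\<eta>. B1 s \<eta> u) has_derivative B2 s \<xi> u) (at \<xi>)"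
        "\<And>\<xi> s u v. \<xi> \<in> U \<Longrightarrow> s \<in> {0..1} \<Longrightarrow> ((\<lambda>\<eta>. B2 s \<eta> u v) has_derivative B3 s \<xi> u v) (at \<xi>)"
      and V: "\<And>\<xi> s u. \<xi> \<in> U \<Longrightarrow> s \<in> {0..1} \<Longrightarrow>
        ((\<lambda>s. A1 s \<xi> u) has_vector_derivative B1 s \<xi> u) (at s within {0..1})"
        "\<And>\<xi> s u v. \<xi> \<in> U \<Longrightarrow> s \<in> {0..1} \<Longrightarrow>
        ((\<lambda>s. A2 s \<xi> u v) has_vector_derivative B2 s \<xi> u v) (at s within {0..1})"
        "\<And>\<xi> s u v w. \<xi> \<in> U \<Longrightarrow> s \<in> {0..1} \<Longrightarrow>
        ((\<lambda>s. A3 s \<xi> u v w) has_vector_derivative B3 s \<xi> u v w) (at s within {0..1})"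
      and D: "\<And>s h. s \<in> {0..<1} \<Longrightarrow> D1 (\<phi> (\<tau> + s * T) \<tau>) \<xi> *v h = A1 s \<xi> h"
        "\<And>s h. s \<in> {0..<1} \<Longrightarrow> D2 (\<phi> (\<tau> + s * T) \<tau>) \<xi> *v (h \<otimes> h) = A2 s \<xi> h h"
        "\<And>s h. s \<in> {0..<1} \<Longrightarrow> D3 (\<phi> (\<tau> + s * T) \<tau>) \<xi> *v (h \<otimes> h \<otimes> h) = A3 s \<xi> h h h"
    define L where "L s y = M s y + (c' s \<bullet> y) *\<^sub>R X \<xi> s + (c' s \<bullet> X \<xi> s) *\<^sub>R y" for s y
    have L_lin: "linear (L s)" for s
      unfolding L_def
      by (rule linearI) (simp_all add: linear_add[OF bounded_linear.linear[OF M]] linear_scale[OF bounded_linear.linear[OF M]]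
          algebra_simps)
    \<comment> \<open>Recognising \<open>L s\<close> as the derivative of the right-hand side lets
      it inherit the uniform bound of \<open>C1x_lipschitz\<close> along the trajectory.\<close>
    have L_deriv: "L s = F' s (X \<xi> s)" if s: "s \<in> {0..1}" for s
    proof -
      have "((\<lambda>x. T *\<^sub>R a (\<tau> + s * T) + M s x + (c' s \<bullet> x) *\<^sub>R x) has_derivative
          (\<lambda>y. 0 + M s y + ((c' s \<bullet> X \<xi> s) *\<^sub>R y + (c' s \<bullet> y) *\<^sub>R X \<xi> s))) (at (X \<xi> s))"
        by (intro has_derivative_add has_derivative_const has_derivative_scaleR has_derivative_inner_right
            bounded_linear_imp_has_derivative[OF M] has_derivative_ident)
      from has_derivative_unique[OF C1x_has_derivative[OF C1 s] this[folded F[OF s]]]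
      show ?thesis by (auto simp: L_def fun_eq_iff)
    qed
    obtain R where R: "\<And>s. s \<in> {0..1} \<Longrightarrow> norm (X \<xi> s) \<le> R" using solves_bounded[OF X(1)[OF U(2)]] by metis
    obtain K where K: "0 < K" "\<And>s x y. s \<in> {0..1} \<Longrightarrow> x \<in> cball 0 R \<Longrightarrow> norm (F' s x y) \<le> K * norm y"
      using C1x_lipschitz[OF C1 compact_Icc, of R] by metis
    have L_bd: "norm (L s y) \<le> K * norm y" if "s \<in> {0..1}" for s y
      using K(2)[OF that, of "X \<xi> s"] R[OF that] L_deriv[OF that] by simp
    have ric_vars: "B1 s \<xi> h = L s (A1 s \<xi> h)"
      "B2 s \<xi> h h = L s (A2 s \<xi> h h) + (2 * (c' s \<bullet> A1 s \<xi> h)) *\<^sub>R A1 s \<xi> h"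
      "B3 s \<xi> h h h = L s (A3 s \<xi> h h h) + (3 * (c' s \<bullet> A2 s \<xi> h h)) *\<^sub>R A1 s \<xi> h
        + (3 * (c' s \<bullet> A1 s \<xi> h)) *\<^sub>R A2 s \<xi> h h" if s: "s \<in> {0..1}" for s
      using riccati_third_order_variations[OF U(1) M A(1)[OF _ s] A(2)[OF _ s] A(3)[OF _ s] B(1)[OF _ s, unfolded F[OF s]] B(2)[OF _ s] B(3)[OF _ s] U(2)]
      unfolding L_def by blast+
    have init: "A2 0 \<xi> h h = 0" "A3 0 \<xi> h h h = 0"
      using flow_variations_initial[OF U(1) X(2) A(1) A(2) A(3) U(2)] by auto
    have "continuous_on {0..1} (\<lambda>s. A1 s \<xi> h)"
      unfolding continuous_on_eq_continuous_within
      using V(1)[OF U(2)] has_vector_derivative_continuous by blast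
    then have m_cont: "continuous_on {0..1} (\<lambda>s. c' s \<bullet> A1 s \<xi> h)"
      by (intro continuous_intros c'_cont)
    have "\<sigma> \<in> {0..1}" using \<sigma>(1) by auto
    obtain k where "A2 \<sigma> \<xi> h h = k *\<^sub>R A1 \<sigma> \<xi> h" "A3 \<sigma> \<xi> h h h = (3 / 2 * k\<^sup>2) *\<^sub>R A1 \<sigma> \<xi> h"
    proof (rule riccati_variations_proportional[where L = L and K = K and c = c' and s = \<sigma>
          and m = "\<lambda>s. c' s \<bullet> A1 s \<xi> h"
          and ?u1.0 = "\<lambda>s. A1 s \<xi> h" and ?u2.0 = "\<lambda>s. A2 s \<xi> h h" and ?u3.0 = "\<lambda>s. A3 s \<xi> h h h"])
      show "((\<lambda>s. A1 s \<xi> h) has_vector_derivative L s (A1 s \<xi> h)) (at s within {0..1})" if "s \<in> {0..1}" for s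
        using V(1)[OF U(2) that, of h] ric_vars(1)[OF that] by simp
      show "((\<lambda>s. A2 s \<xi> h h) has_vector_derivative L s (A2 s \<xi> h h) + (2 * (c' s \<bullet> A1 s \<xi> h)) *\<^sub>R A1 s \<xi> h)
          (at s within {0..1})" if "s \<in> {0..1}" for s
        using V(2)[OF U(2) that, of h h] ric_vars(2)[OF that] by simp
      show "((\<lambda>s. A3 s \<xi> h h h) has_vector_derivative L s (A3 s \<xi> h h h) + (3 * (c' s \<bullet> A2 s \<xi> h h)) *\<^sub>R A1 s \<xi> h
          + (3 * (c' s \<bullet> A1 s \<xi> h)) *\<^sub>R A2 s \<xi> h h) (at s within {0..1})" if "s \<in> {0..1}" for s
        using V(3)[OF U(2) that, of h h h] ric_vars(3)[OF that] by simp
      show "linear (L s)" for s by (rule L_lin)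
      show "norm (L s y) \<le> K * norm y" if "s \<in> {0..1}" for s y by (rule L_bd[OF that])
    qed (use K(1) init m_cont \<open>\<sigma> \<in> {0..1}\<close> in auto)
    then show ?thesis
      unfolding \<sigma>(2) D[OF \<sigma>(1)] by (rule kronecker_identity_of_proportional)
  qed
qed

lemma identity_imp_differentials:
  fixes f :: "real \<Rightarrow> real ^ 'n::finite \<Rightarrow> real ^ 'n"
  assumes C: "C_in_x 3 I f"
    and max: "\<And>\<tau> \<xi>. \<tau> \<in> I \<Longrightarrow> maximal_ivp_solution I f \<tau> \<xi> (J \<tau> \<xi>) (\<lambda>t. \<phi> t \<tau> \<xi>)"
    and id: "\<And>t h. t \<in> J \<tau> \<xi> \<Longrightarrow>
      (D3 (\<phi> t \<tau>) \<xi> *v (h \<otimes> h \<otimes> h)) \<otimes> (D1 (\<phi> t \<tau>) \<xi> *v h) + (D1 (\<phi> t \<tau>) \<xi> *v h) \<otimes> (D3 (\<phi> t \<tau>) \<xi> *v (h \<otimes> h \<otimes> h))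
      - 3 *\<^sub>R ((D2 (\<phi> t \<tau>) \<xi> *v (h \<otimes> h)) \<otimes> (D2 (\<phi> t \<tau>) \<xi> *v (h \<otimes> h))) = 0"
    and "\<tau> \<in> I"
    and P1: "\<And>x. (f \<tau> has_derivative P1 x) (at x)"
    and P2: "\<And>x u. ((\<lambda>x. P1 x u) has_derivative P2 x u) (at x)"
    and P3: "\<And>x u v. ((\<lambda>x. P2 x u v) has_derivative P3 x u v) (at x)"
  shows "P2 \<xi> h h $ i * h $ j = P2 \<xi> h h $ j * h $ i" and "P3 \<xi> h h h = 0"
proof -
  have J: "open (J \<tau> \<xi>)" "\<tau> \<in> J \<tau> \<xi>"
    using max[OF \<open>\<tau> \<in> I\<close>, of \<xi>] by (auto simp: maximal_ivp_solution_def ivp_solution_def)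
  obtain T where T: "T \<noteq> 0" "\<tau> + T \<in> J \<tau> \<xi>"
    using rescaling_exists[OF J, of \<tau>] by metis
  have "(\<forall>i j. P2 \<xi> h h $ i * h $ j = P2 \<xi> h h $ j * h $ i) \<and> P3 \<xi> h h h = 0"
  proof (rule maximal_flow_third_order_variations[OF C max \<open>\<tau> \<in> I\<close> T(2,1)])
    fix U X A1 A2 A3 B1 B2 B3
    assume U: "open U" "\<xi> \<in> U"
      and X: "\<And>\<eta>. \<eta> \<in> U \<Longrightarrow> X \<eta> 0 = \<eta>"
      and \<phi>: "\<And>\<eta> s. \<eta> \<in> U \<Longrightarrow> s \<in> {0..<1} \<Longrightarrow> \<tau> + s * T \<in> J \<tau> \<eta> \<and> \<phi> (\<tau> + s * T) \<tau> \<eta> = X \<eta> s"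
      and A: "\<And>\<xi> s. \<xi> \<in> U \<Longrightarrow> s \<in> {0..1} \<Longrightarrow> ((\<lambda>\<eta>. X \<eta> s) has_derivative A1 s \<xi>) (at \<xi>)"
        "\<And>\<xi> s u. \<xi> \<in> U \<Longrightarrow> s \<in> {0..1} \<Longrightarrow> ((\<lambda>\<eta>. A1 s \<eta> u) has_derivative A2 s \<xi> u) (at \<xi>)"
        "\<And>\<xi> s u v. \<xi> \<in> U \<Longrightarrow> s \<in> {0..1} \<Longrightarrow> ((\<lambda>\<eta>. A2 s \<eta> u v) has_derivative A3 s \<xi> u v) (at \<xi>)"
      and B: "\<And>\<xi> s. \<xi> \<in> U \<Longrightarrow> s \<in> {0..1} \<Longrightarrow> ((\<lambda>\<eta>. rescaled f \<tau> T s (X \<eta> s)) has_derivative B1 s \<xi>) (at \<xi>)"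
        "\<And>\<xi> s u. \<xi> \<in> U \<Longrightarrow> s \<in> {0..1} \<Longrightarrow> ((\<lambda>\<eta>. B1 s \<eta> u) has_derivative B2 s \<xi> u) (at \<xi>)"
        "\<And>\<xi> s u v. \<xi> \<in> U \<Longrightarrow> s \<in> {0..1} \<Longrightarrow> ((\<lambda>\<eta>. B2 s \<eta> u v) has_derivative B3 s \<xi> u v) (at \<xi>)"
      and V: "\<And>\<xi> s u. \<xi> \<in> U \<Longrightarrow> s \<in> {0..1} \<Longrightarrow>
        ((\<lambda>s. A1 s \<xi> u) has_vector_derivative B1 s \<xi> u) (at s within {0..1})"
        "\<And>\<xi> s u v. \<xi> \<in> U \<Longrightarrow> s \<in> {0..1} \<Longrightarrow>
        ((\<lambda>s. A2 s \<xi> u v) has_vector_derivative B2 s \<xi> u v) (at s within {0..1})"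
        "\<And>\<xi> s u v w. \<xi> \<in> U \<Longrightarrow> s \<in> {0..1} \<Longrightarrow>
        ((\<lambda>s. A3 s \<xi> u v w) has_vector_derivative B3 s \<xi> u v w) (at s within {0..1})"
      and D: "\<And>s h. s \<in> {0..<1} \<Longrightarrow> D1 (\<phi> (\<tau> + s * T) \<tau>) \<xi> *v h = A1 s \<xi> h"
        "\<And>s h. s \<in> {0..<1} \<Longrightarrow> D2 (\<phi> (\<tau> + s * T) \<tau>) \<xi> *v (h \<otimes> h) = A2 s \<xi> h h"
        "\<And>s h. s \<in> {0..<1} \<Longrightarrow> D3 (\<phi> (\<tau> + s * T) \<tau>) \<xi> *v (h \<otimes> h \<otimes> h) = A3 s \<xi> h h h"
    have init: "A1 0 \<xi> h = h" "A2 0 \<xi> h h = 0" "A3 0 \<xi> h h h = 0"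
      using flow_variations_initial[OF U(1) X A(1) A(2) A(3) U(2)] by auto
    \<comment> \<open>At \<open>s = 0\<close> the state is \<eta> itself, so the \<open>B\<close>
      forms there are the differentials of \<open>f \<tau>\<close> times the scale factor
      \<open>T\<close>. They are identified one order after another by uniqueness of
      derivatives.\<close>
    have B1: "B1 0 \<eta> u = T *\<^sub>R P1 \<eta> u" if "\<eta> \<in> U" for \<eta> u
    proof -
      have "((\<lambda>\<eta>. rescaled f \<tau> T 0 (X \<eta> 0)) has_derivative (\<lambda>u. T *\<^sub>R P1 \<eta> u)) (at \<eta>)"
        by (rule has_derivative_transform_within_open[OF has_derivative_scaleR_right[OF P1] U(1) that])
          (simp add: rescaled_def X)
      from has_derivative_unique[OF B(1)[OF that] this] show ?thesis by simp
    qed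
    have B2: "B2 0 \<eta> u v = T *\<^sub>R P2 \<eta> u v" if "\<eta> \<in> U" for \<eta> u v
    proof -
      have "((\<lambda>\<eta>. B1 0 \<eta> u) has_derivative (\<lambda>v. T *\<^sub>R P2 \<eta> u v)) (at \<eta>)"
        by (rule has_derivative_transform_within_open[OF has_derivative_scaleR_right[OF P2] U(1) that])
          (simp add: B1)
      from has_derivative_unique[OF B(2)[OF that] this] show ?thesis by simp
    qed
    have B3: "B3 0 \<xi> u v w = T *\<^sub>R P3 \<xi> u v w" for u v w
    proof -
      have "((\<lambda>\<eta>. B2 0 \<eta> u v) has_derivative (\<lambda>w. T *\<^sub>R P3 \<xi> u v w)) (at \<xi>)"
        by (rule has_derivative_transform_within_open[OF has_derivative_scaleR_right[OF P3] U(1,2)])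
          (simp add: B2)
      from has_derivative_unique[OF B(3)[OF U(2)] this] show ?thesis by simp
    qed
    have nth: "((\<lambda>s. g s $ i) has_real_derivative g' $ i) (at 0 within {0..1})"
      if "(g has_vector_derivative g') (at 0 within {0..1})" for g :: "real \<Rightarrow> real ^ 'n" and g' i
      using bounded_linear.has_vector_derivative[OF bounded_linear_vec_nth that]
      by (simp add: has_real_derivative_iff_has_vector_derivative)
    have d1: "((\<lambda>s. A1 s \<xi> h $ i) has_real_derivative B1 0 \<xi> h $ i) (at 0 within {0..1})" for i
      by (rule nth[OF V(1)]) (use U in auto)
    have d2: "((\<lambda>s. A2 s \<xi> h h $ i) has_real_derivative T * P2 \<xi> h h $ i) (at 0 within {0..1})" for i
      using nth[OF V(2)[OF U(2)], of h h i] by (simp add: B2 U)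
    have d3: "((\<lambda>s. A3 s \<xi> h h h $ i) has_real_derivative T * P3 \<xi> h h h $ i) (at 0 within {0..1})" for i
      using nth[OF V(3)[OF U(2)], of h h h i] by (simp add: B3)
    have id': "A3 s \<xi> h h h \<otimes> A1 s \<xi> h + A1 s \<xi> h \<otimes> A3 s \<xi> h h h - 3 *\<^sub>R (A2 s \<xi> h h \<otimes> A2 s \<xi> h h) = 0"
      if "s \<in> {0..<1}" for s
      using id[of "\<tau> + s * T" h] \<phi>[OF U(2) that] D[OF that] by simp
    have "P2 \<xi> h h $ i * h $ j = P2 \<xi> h h $ j * h $ i" for i j
    proof -
      \<comment> \<open>In the product rule only the derivative of \<open>A2\<close> survives,
        because \<open>A2\<close> is 0 and \<open>A1\<close> is \<open>h\<close> at
        \<open>s = 0\<close>.\<close>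
      have "((\<lambda>s. A2 s \<xi> h h $ i * A1 s \<xi> h $ j - A2 s \<xi> h h $ j * A1 s \<xi> h $ i) has_real_derivative
          T * P2 \<xi> h h $ i * h $ j - T * P2 \<xi> h h $ j * h $ i) (at 0 within {0..1})"
        by (auto intro!: derivative_eq_intros d1 d2 simp: init)
      then have "T * P2 \<xi> h h $ i * h $ j - T * P2 \<xi> h h $ j * h $ i = 0"
        unfolding has_real_derivative_iff_has_vector_derivative
        by (rule right_derivative_zero) (simp add: kronecker_identity_parallel[OF id'])
      with T(1) show ?thesis by simp
    qed
    moreover have P3_eq: "P3 \<xi> h h h $ i * h $ j + h $ i * P3 \<xi> h h h $ j = 0" for i j
    proof -
      \<comment> \<open>The product of two \<open>A2\<close> factors has derivative 0 at
        \<open>s = 0\<close>, where both factors vanish; what remains concerns the third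
        differential alone.\<close>
      have "((\<lambda>s. A3 s \<xi> h h h $ i * A1 s \<xi> h $ j + A1 s \<xi> h $ i * A3 s \<xi> h h h $ j - 3 * (A2 s \<xi> h h $ i * A2 s \<xi> h h $ j))
          has_real_derivative T * P3 \<xi> h h h $ i * h $ j + h $ i * (T * P3 \<xi> h h h $ j)) (at 0 within {0..1})"
        by (auto intro!: derivative_eq_intros d1 d2 d3 simp: init)
      then have "T * P3 \<xi> h h h $ i * h $ j + h $ i * (T * P3 \<xi> h h h $ j) = 0"
        unfolding has_real_derivative_iff_has_vector_derivative
        by (rule right_derivative_zero) (simp add: kronecker_identity_nth[OF id'])
      then have "T * (P3 \<xi> h h h $ i * h $ j + h $ i * P3 \<xi> h h h $ j) = 0" by (simp add: algebra_simps)
      with T(1) show ?thesis by simp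
    qed
    moreover have "P3 \<xi> h h h = 0"
    proof (cases "h = 0")
      case True
      then show ?thesis
        using linear_0[OF has_derivative_linear[OF P3]] by simp
    next
      case False
      \<comment> \<open>The diagonal entry \<open>(j, j)\<close> removes component \<open>j\<close>
        of the third differential, and then the entries \<open>(i, j)\<close> remove all
        others.\<close>
      then obtain j where j: "h $ j \<noteq> 0" by (auto simp: vec_eq_iff)
      then have "P3 \<xi> h h h $ j = 0" using P3_eq[of j j] by simp
      then have "P3 \<xi> h h h $ i = 0" for i using P3_eq[of i j] j by simp
      then show ?thesis by (simp add: vec_eq_iff)
    qed
    ultimately show "(\<forall>i j. P2 \<xi> h h $ i * h $ j = P2 \<xi> h h $ j * h $ i) \<and> P3 \<xi> h h h = 0" by blast
  qed
  then show "P2 \<xi> h h $ i * h $ j = P2 \<xi> h h $ j * h $ i" and "P3 \<xi> h h h = 0" by auto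
qed

section \<open>Recovering the Riccati form\<close>

text \<open>\<open>E s\<close> is the value at \<open>x\<close> of the second Taylor polynomial of
  \<open>g\<close> about \<open>s *\<^sub>R x\<close>. Its derivative telescopes to a multiple of
  the third differential in direction \<open>x\<close>, which is 0, so \<open>E\<close> takes the
  same value at 0 and 1.\<close>

lemma second_order_taylor:
  fixes g :: "'a::real_normed_vector \<Rightarrow> 'b::real_normed_vector"
  assumes P1: "\<And>x. (g has_derivative P1 x) (at x)"
    and P2: "\<And>x u. ((\<lambda>x. P1 x u) has_derivative P2 x u) (at x)"
    and P3: "\<And>x u v. ((\<lambda>x. P2 x u v) has_derivative P3 x u v) (at x)"
    and zero: "\<And>x h. P3 x h h h = 0"
  shows "g x = g 0 + P1 0 x + (1 / 2) *\<^sub>R P2 0 x x"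
proof -
  have line: "((\<lambda>s. q (s *\<^sub>R x)) has_vector_derivative q' (s *\<^sub>R x) x) (at s)"
    if "\<And>y. (q has_derivative q' y) (at y)" for q :: "'a \<Rightarrow> 'b" and q' s
  proof -
    have "((\<lambda>s. s *\<^sub>R x) has_derivative (\<lambda>r. r *\<^sub>R x)) (at s)" by (auto intro!: derivative_eq_intros)
    from has_derivative_compose[OF this that]
    show ?thesis
      unfolding has_vector_derivative_def by (simp add: linear_cmul[OF has_derivative_linear[OF that]])
  qed
  define E where "E s = g (s *\<^sub>R x) + (1 - s) *\<^sub>R P1 (s *\<^sub>R x) x + ((1 - s)\<^sup>2 / 2) *\<^sub>R P2 (s *\<^sub>R x) x x" for s :: real
  have c1: "((\<lambda>s. 1 - s) has_real_derivative - 1) (at s)" for s :: real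
    by (auto intro!: derivative_eq_intros)
  have c2: "((\<lambda>s. (1 - s)\<^sup>2 / 2) has_real_derivative - (1 - s)) (at s)" for s :: real
    by (auto intro!: derivative_eq_intros)
  have "(E has_vector_derivative P1 (s *\<^sub>R x) x + ((1 - s) *\<^sub>R P2 (s *\<^sub>R x) x x + (- 1) *\<^sub>R P1 (s *\<^sub>R x) x)
      + (((1 - s)\<^sup>2 / 2) *\<^sub>R P3 (s *\<^sub>R x) x x x + (- (1 - s)) *\<^sub>R P2 (s *\<^sub>R x) x x)) (at s)" for s
    unfolding E_def
    by (intro has_vector_derivative_add has_vector_derivative_scaleR c1 c2 line P1 P2 P3)
  then have "(E has_vector_derivative 0) (at s)" for s by (simp add: zero flip: scaleR_add_left)
  then have "(E has_derivative (\<lambda>h. 0)) (at s within UNIV)" for s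
    by (simp add: has_vector_derivative_def)
  then obtain k where "\<forall>s\<in>UNIV. E s = k"
    using has_derivative_zero_constant[of UNIV E] by auto
  then have "E 1 = E 0" by simp
  then show ?thesis by (simp add: E_def)
qed

lemma vector_riccatiI:
  fixes f :: "real \<Rightarrow> real ^ 'n::finite \<Rightarrow> real ^ 'n"
  assumes cont: "continuous_on I (\<lambda>t. f t 0)" "\<And>i. continuous_on I (\<lambda>t. p1 i t)" "\<And>i j. continuous_on I (\<lambda>t. p2 i j t)"
    and f: "\<And>t x. t \<in> I \<Longrightarrow> f t x = f t 0 + (\<Sum>i\<in>UNIV. x $ i *\<^sub>R p1 i t)
      + (1 / 2) *\<^sub>R (\<Sum>i\<in>UNIV. x $ i *\<^sub>R (\<Sum>j\<in>UNIV. x $ j *\<^sub>R p2 i j t))"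
    and par: "\<And>t x k l. t \<in> I \<Longrightarrow> (\<Sum>i\<in>UNIV. x $ i *\<^sub>R (\<Sum>j\<in>UNIV. x $ j *\<^sub>R p2 i j t)) $ k * x $ l
      = (\<Sum>i\<in>UNIV. x $ i *\<^sub>R (\<Sum>j\<in>UNIV. x $ j *\<^sub>R p2 i j t)) $ l * x $ k"
  shows "vector_riccati I f"
proof -
  define B :: "real \<Rightarrow> real ^ 'n ^ 'n" where "B t = (\<chi> r i. p1 i t $ r)" for t
  \<comment> \<open>The diagonal entries are those found in \<open>quadratic_parallel\<close>; the
    division by 2 is the Taylor factor.\<close>
  define c :: "real \<Rightarrow> real ^ 'n" where "c t = (\<chi> i. p2 i i t $ i / 2)" for t
  have "continuous_on I B" "continuous_on I c"
    unfolding B_def c_def by (intro continuous_on_vec_lambda continuous_intros cont; simp)+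
  moreover have "f t x = f t 0 + B t *v x + (c t \<bullet> x) *\<^sub>R x" if "t \<in> I" for t x
  proof -
    have "B t *v x = (\<Sum>i\<in>UNIV. x $ i *\<^sub>R p1 i t)"
      by (simp add: B_def vec_eq_iff matrix_vector_mult_def mult.commute)
    moreover have "c t = (1 / 2) *\<^sub>R (\<chi> i. p2 i i t $ i)" by (simp add: c_def vec_eq_iff)
    ultimately show ?thesis
      using f[OF that, of x] quadratic_parallel[of "\<lambda>i j. p2 i j t" x, OF par[OF that]] by simp
  qed
  ultimately show ?thesis unfolding vector_riccati_def using cont(1) by blast
qed

theorem theorem5p1:
  fixes I :: "real set"
    and f :: "real \<Rightarrow> real ^ 'n::finite \<Rightarrow> real ^ 'n"
    and J :: "real \<Rightarrow> real ^ 'n \<Rightarrow> real set"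
    and \<phi> :: "real \<Rightarrow> real \<Rightarrow> real ^ 'n \<Rightarrow> real ^ 'n"
  assumes "open I" and "is_interval I" and "I \<noteq> {}"
    and "continuous_on (I \<times> UNIV) (\<lambda>(t, x). f t x)"
    and "C_in_x 3 I f"
    and "\<And>\<tau> \<xi>. \<tau> \<in> I \<Longrightarrow> maximal_ivp_solution I f \<tau> \<xi> (J \<tau> \<xi>) (\<lambda>t. \<phi> t \<tau> \<xi>)"
  shows "vector_riccati I f \<longleftrightarrow>
    (\<forall>\<tau>\<in>I. \<forall>\<xi>. \<forall>t\<in>J \<tau> \<xi>. \<forall>h.
       let d1 = D1 (\<phi> t \<tau>) \<xi> *v h;
           d2 = D2 (\<phi> t \<tau>) \<xi> *v (h \<otimes> h);
           d3 = D3 (\<phi> t \<tau>) \<xi> *v (h \<otimes> h \<otimes> h)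
       in d3 \<otimes> d1 + d1 \<otimes> d3 - 3 *\<^sub>R (d2 \<otimes> d2) = 0)"
    (is "_ \<longleftrightarrow> ?id")
proof
  assume "vector_riccati I f"
  then show ?id
    unfolding Let_def
    by (intro ballI allI vector_riccati_imp_identity[OF assms(5,6)])
next
  assume id: ?id
  define p1 where "p1 i t x = partial_deriv i (f t) x" for i t x
  define p2 where "p2 i j t x = partial_deriv j (partial_deriv i (f t)) x" for i j t x
  define p3 where "p3 i j k t x = partial_deriv k (partial_deriv j (partial_deriv i (f t))) x" for i j k t x
  have C3: "C_in_x (Suc (Suc (Suc 0))) I f" using assms(5) by (simp add: numeral_3_eq_3)
  have C2: "C_in_x (Suc (Suc 0)) I (p1 i)" for i
    using C_in_x_partial_deriv[OF C3, of i] by (simp only: p1_def[abs_def])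
  have C1: "C_in_x (Suc 0) I (p2 i j)" for i j
    using C_in_x_partial_deriv[OF C2, of j i] by (simp only: p1_def[abs_def] p2_def[abs_def])
  define P1 where "P1 t x u = (\<Sum>i\<in>UNIV. u $ i *\<^sub>R p1 i t x)" for t x u
  define P2 where "P2 t x u v = (\<Sum>i\<in>UNIV. u $ i *\<^sub>R (\<Sum>j\<in>UNIV. v $ j *\<^sub>R p2 i j t x))" for t x u v
  define P3 where "P3 t x u v w = (\<Sum>i\<in>UNIV. u $ i *\<^sub>R (\<Sum>j\<in>UNIV. v $ j *\<^sub>R (\<Sum>k\<in>UNIV. w $ k *\<^sub>R p3 i j k t x)))"
    for t x u v w
  have P1: "(f t has_derivative P1 t x) (at x)" if "t \<in> I" for t x
    using C_in_x_has_derivative[OF C3 that] by (simp add: P1_def[abs_def] p1_def)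
  have P2: "((\<lambda>x. P1 t x u) has_derivative P2 t x u) (at x)" if "t \<in> I" for t x u
    using C_in_x_has_derivative[OF C2 that] unfolding P1_def P2_def p2_def p1_def
    by (intro has_derivative_sum has_derivative_scaleR_right) blast
  have P3: "((\<lambda>x. P2 t x u v) has_derivative P3 t x u v) (at x)" if "t \<in> I" for t x u v
    using C_in_x_has_derivative[OF C1 that] unfolding P2_def P3_def p3_def p2_def
    by (intro has_derivative_sum has_derivative_scaleR_right) blast
  \<comment> \<open>The identity is used with \<open>t\<close> as initial time. Vanishing of the
    third differential is needed at every point for Taylor's formula, the parallelism only at the
    origin, where the quadratic part is read off.\<close>
  note diff = identity_imp_differentials[OF assms(5,6) id[unfolded Let_def, rule_format] _ P1 P2 P3]
  have cont: "continuous_on I (\<lambda>t. g t 0)" if "C_in_x k I g" for k and g :: "real \<Rightarrow> real ^ 'n \<Rightarrow> real ^ 'n"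
    by (rule continuous_on_compose_Pair[OF C_in_x_continuous_on[OF that]]) auto
  show "vector_riccati I f"
  proof (rule vector_riccatiI[where ?p1.0 = "\<lambda>i t. p1 i t 0" and ?p2.0 = "\<lambda>i j t. p2 i j t 0"])
    fix t x assume t: "t \<in> I"
    show "f t x = f t 0 + (\<Sum>i\<in>UNIV. x $ i *\<^sub>R p1 i t 0)
        + (1 / 2) *\<^sub>R (\<Sum>i\<in>UNIV. x $ i *\<^sub>R (\<Sum>j\<in>UNIV. x $ j *\<^sub>R p2 i j t 0))"
      using second_order_taylor[OF P1[OF t] P2[OF t] P3[OF t], of x] diff(2) t by (simp add: P1_def P2_def)
    show "(\<Sum>i\<in>UNIV. x $ i *\<^sub>R (\<Sum>j\<in>UNIV. x $ j *\<^sub>R p2 i j t 0)) $ k * x $ l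
      = (\<Sum>i\<in>UNIV. x $ i *\<^sub>R (\<Sum>j\<in>UNIV. x $ j *\<^sub>R p2 i j t 0)) $ l * x $ k" for k l
      using diff(1)[of t 0 x k l] t by (simp add: P2_def)
  qed (intro cont[OF C3] cont[OF C2] cont[OF C1])+
qed

end
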